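(* Let $f,g:\mathbb{R}^n\to\mathbb{R}^n$ be of class $C^2$ and suppose there are constants $\mu\in\mathbb{R}$, $c>0$ and $\sigma$ such that for all $x,y\in\mathbb{R}^n$ $$\langle x-y,f(x)-f(y)\rangle\le\mu|x-y|^2,\qquad |g(x)-g(y)|^2\le c|x-y|^2,\qquad |L^1g(x)-L^1g(y)|^2\le\sigma|x-y|^2 .$$ Suppose moreover that $f$ satisfies the linear growth condition: there is a constant $K>0$ with $|f(x)|^2\le K(1+|x|^2)$ for all $x\in\mathbb{R}^n$. Put $\beta:=\max\{\mu+\tfrac12,\,2c\}$. Let $\theta\in[0,1/2)$, $T>0$ and $x_0\in\mathbb{R}^n$, and let $\Delta_1:=1/(2\theta\beta)$ (with $\Delta_1=\infty$ if $\theta=0$). Then for each $p\ge2$ there is a constant $C>0$, independent of the stepsize $\Delta$, such that for every stepsize $\Delta=T/N$ ($N$ a positive integer) with $\Delta<\Delta_1$, the stochastic theta-Milstein approximation $\{y_k\}$ and the split-step theta-Milstein approximation $\{z_k\}$ with initial value $y_0=x_0$ satisfy $$\mathbb{E}\Big[\sup_{k\Delta\in[0,T]}|y_k|^p\Big]\le C\qquad\text{and}\qquad \mathbb{E}\Big[\sup_{k\Delta\in[0,T]}|z_k|^p\Big]\le C .$$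
   Context: $|\cdot|$ is the Euclidean norm and $\langle x,y\rangle=x^Ty$ on $\mathbb{R}^n$. $(w(t))_{t\ge0}$ is a one-dimensional Brownian motion on a complete filtered probability space $(\Omega,\mathfrak{F},\{\mathfrak{F}_t\}_{t\ge0},\mathbb{P})$ satisfying the usual conditions. The underlying SDE is $dx(t)=f(x(t))dt+g(x(t))dw(t)$, $x(0)=x_0\in\mathbb{R}^n$. Here $L^1=g(x)\frac{\partial}{\partial x}$, i.e. $L^1g(x)=g'(x)g(x)=\sum_{i=1}^n g^i(x)\frac{\partial g}{\partial x^i}(x)\in\mathbb{R}^n$. For $\theta\in[0,1]$, a stepsize $\Delta$ with $\theta\mu\Delta<1$ and $\Delta w_k:=w((k+1)\Delta)-w(k\Delta)$, set $y_0=x_0$, $z_0=y_0-\theta f(y_0)\Delta$ and, for $k=0,1,2,\dots$, $$z_{k+1}=z_k+f(y_k)\Delta+g(y_k)\Delta w_k+\tfrac12L^1g(y_k)\big(|\Delta w_k|^2-\Delta\big),\qquad y_{k}=z_{k}+\theta f(y_{k})\Delta,$$ where, for each $k$, $y_k$ is the unique solution $y$ of $y=z_k+\theta\Delta f(y)$ (uniquely solvable by the one-sided Lipschitz condition on $f$ and $\theta\mu\Delta<1$). $\{z_k\}$ is called the split-step theta-Milstein (SSTM) approximation and $\{y_k\}$ the stochastic theta-Milstein (STM) approximation. *)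

theory Defs
  imports "HOL-Probability.Probability"
begin

text \<open>The filtration is indexed by all reals, but only the indices \<open>t \<ge> 0\<close> are constrained.\<close>

locale usual_filtered_prob_space = prob_space M + complete_measure M
  for M :: "'a measure" +
  fixes F :: "real \<Rightarrow> 'a measure"
  assumes subalgebra_F: "\<And>t. 0 \<le> t \<Longrightarrow> subalgebra M (F t)"
    and F_mono: "\<And>s t. 0 \<le> s \<Longrightarrow> s \<le> t \<Longrightarrow> sets (F s) \<subseteq> sets (F t)"
    and F_right_continuous: "\<And>t. 0 \<le> t \<Longrightarrow> sets (F t) = (\<Inter>s\<in>{t<..}. sets (F s))"
    and F_null_sets: "null_sets M \<subseteq> sets (F 0)"

locale brownian_motion = usual_filtered_prob_space M F
  for M :: "'a measure" and F :: "real \<Rightarrow> 'a measure" +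
  fixes w :: "real \<Rightarrow> 'a \<Rightarrow> real"
  assumes adapted: "\<And>t. 0 \<le> t \<Longrightarrow> w t \<in> borel_measurable (F t)"
    and starts_at_0: "AE \<omega> in M. w 0 \<omega> = 0"
    and continuous_paths: "AE \<omega> in M. continuous_on {0..} (\<lambda>t. w t \<omega>)"
    and independent_increments: "\<And>s t. 0 \<le> s \<Longrightarrow> s < t \<Longrightarrow>
      indep_set (sets (F s)) {(\<lambda>\<omega>. w t \<omega> - w s \<omega>) -` A \<inter> space M | A. A \<in> sets borel}"
    and normal_increments: "\<And>s t. 0 \<le> s \<Longrightarrow> s < t \<Longrightarrow>
      distributed M lborel (\<lambda>\<omega>. w t \<omega> - w s \<omega>) (normal_density 0 (sqrt (t - s)))"

definition C2 :: "('a::real_normed_vector \<Rightarrow> 'b::real_normed_vector) \<Rightarrow> bool" where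
  "C2 h \<longleftrightarrow> (\<exists>(h' :: 'a \<Rightarrow> 'a \<Rightarrow>\<^sub>L 'b) (h'' :: 'a \<Rightarrow> 'a \<Rightarrow>\<^sub>L ('a \<Rightarrow>\<^sub>L 'b)).
     (\<forall>x. (h has_derivative blinfun_apply (h' x)) (at x)) \<and>
     (\<forall>x. (h' has_derivative blinfun_apply (h'' x)) (at x)) \<and>
     continuous_on UNIV h'')"

text \<open>The first-order operator \<open>L\<^sup>1 = \<Sum>\<^sub>i g\<^sup>i \<partial>/\<partial>x\<^sup>i\<close> with coefficient \<open>g\<close>, applied to \<open>\<phi>\<close>;
  \<open>frechet_derivative \<phi> (at x) (axis i 1)\<close> is the partial derivative of \<open>\<phi>\<close> in direction \<open>i\<close>.
  \<open>L\<^sup>1 g\<close> in the Milstein scheme is \<open>L1 g g\<close>.\<close>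

definition L1 :: "(real^'n \<Rightarrow> real^'n) \<Rightarrow> (real^'n \<Rightarrow> real^'n) \<Rightarrow> real^'n \<Rightarrow> real^'n" where
  "L1 g \<phi> x = (\<Sum>i\<in>UNIV. (g x $ i) *\<^sub>R frechet_derivative \<phi> (at x) (axis i 1))"

lemma L1_eq_frechet_derivative:
  assumes "\<phi> differentiable (at x)"
  shows "L1 g \<phi> x = frechet_derivative \<phi> (at x) (g x)"
proof -
  interpret D: linear "frechet_derivative \<phi> (at x)"
    using assms by (rule linear_frechet_derivative)
  have "frechet_derivative \<phi> (at x) (\<Sum>i\<in>UNIV. (g x $ i) *\<^sub>R axis i 1) = L1 g \<phi> x"
    by (simp add: L1_def D.sum D.scaleR)
  then show ?thesis
    using basis_expansion[of "g x"] by (simp add: scalar_mult_eq_scaleR)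
qed

text \<open>Well defined whenever \<open>f\<close> is continuous and one-sided Lipschitz with constant \<open>\<mu>\<close>, \<open>0 \<le> \<theta> * \<Delta>\<close> and
  \<open>\<theta> * \<mu> * \<Delta> < 1\<close>; otherwise the value may be unspecified.\<close>

definition implicit_solution :: "(real^'n \<Rightarrow> real^'n) \<Rightarrow> real \<Rightarrow> real \<Rightarrow> real^'n \<Rightarrow> real^'n" where
  "implicit_solution f \<theta> \<Delta> z = (THE y. y = z + (\<theta> * \<Delta>) *\<^sub>R f y)"

text \<open>The pair \<open>(y\<^sub>k, z\<^sub>k)\<close> for a given sequence \<open>dw\<close> of driving increments.\<close>

primrec theta_milstein ::
  "(real^'n \<Rightarrow> real^'n) \<Rightarrow> (real^'n \<Rightarrow> real^'n) \<Rightarrow> real \<Rightarrow> real \<Rightarrow> real^'n \<Rightarrow> (nat \<Rightarrow> real) \<Rightarrow> nat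
    \<Rightarrow> (real^'n) \<times> (real^'n)" where
  "theta_milstein f g \<theta> \<Delta> x0 dw 0 = (x0, x0 - (\<theta> * \<Delta>) *\<^sub>R f x0)"
| "theta_milstein f g \<theta> \<Delta> x0 dw (Suc k) =
    (let (y, z) = theta_milstein f g \<theta> \<Delta> x0 dw k;
         z' = z + \<Delta> *\<^sub>R f y + dw k *\<^sub>R g y + ((1/2) * (\<bar>dw k\<bar>\<^sup>2 - \<Delta>)) *\<^sub>R L1 g g y
     in (implicit_solution f \<theta> \<Delta> z', z'))"

definition increment :: "(real \<Rightarrow> 'a \<Rightarrow> real) \<Rightarrow> real \<Rightarrow> 'a \<Rightarrow> nat \<Rightarrow> real" where
  "increment w \<Delta> \<omega> k = w (real (Suc k) * \<Delta>) \<omega> - w (real k * \<Delta>) \<omega>"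

definition STM where
  "STM f g \<theta> \<Delta> x0 w k \<omega> = fst (theta_milstein f g \<theta> \<Delta> x0 (increment w \<Delta> \<omega>) k)"

definition SSTM where
  "SSTM f g \<theta> \<Delta> x0 w k \<omega> = snd (theta_milstein f g \<theta> \<Delta> x0 (increment w \<Delta> \<omega>) k)"

end

theory Submission
  imports Defs
begin

text \<open>
  By the one-sided Lipschitz condition the implicit map is uniformly expansive, so \<open>y\<^sub>k\<close> is a
  continuous function of \<open>z\<^sub>k\<close> of linear growth. With \<open>a\<^sub>k = 1 + |z\<^sub>k|\<^sup>2\<close> and \<open>v\<^sub>k\<close> the normalised
  increments, \<open>a\<^bsub>k+1\<^esub> - a\<^sub>k\<close> is a term linear in \<open>sqrt \<Delta> * v\<^sub>k\<close> plus a remainder bounded by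
  \<open>\<Delta> * a\<^sub>k\<close> times a polynomial in \<open>v\<^sub>k\<close>. This property survives squaring, hence holds for \<open>V = a\<^bsup>m\<^esup>\<close>
  with \<open>m\<close> a power of two. As \<open>v\<^sub>k\<close> is independent of the past, it controls the conditional drift of
  \<open>V\<close> from both sides: the upper bound gives moments growing at most like \<open>exp (C * T)\<close>, and the
  lower bound turns \<open>V\<close> into a submartingale after adding a multiple of \<open>\<Delta> * \<Sum>\<^bsub>j<k\<^esub> V\<^sub>j\<close>, to which
  Doob's \<open>L\<^sup>2\<close> inequality applies.
\<close>

subsection \<open>The implicit equation\<close>

text \<open>Cauchy-Schwarz bounds the inner product by
  \<open>norm (h x - h y) * norm (x - y)\<close>; for distinct points the factor
  \<open>norm (x - y)\<close> cancels.\<close>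

lemma strongly_monotone_expansive:
  fixes h :: "'a::real_inner \<Rightarrow> 'a"
  assumes "m * (norm (x - y))\<^sup>2 \<le> (x - y) \<bullet> (h x - h y)"
  shows "m * norm (x - y) \<le> norm (h x - h y)"
proof (cases "x = y")
  case False
  have "(m * norm (x - y)) * norm (x - y) \<le> norm (h x - h y) * norm (x - y)"
    using assms norm_cauchy_schwarz[of "x - y" "h x - h y"] by (simp add: power2_eq_square mult_ac)
  then show ?thesis
    using False by (simp add: mult_le_cancel_right)
qed simp

lemma expansive_imp_inj:
  fixes h :: "'a::real_normed_vector \<Rightarrow> 'b::real_normed_vector"
  assumes "0 < m" "\<And>x y. m * norm (x - y) \<le> norm (h x - h y)"
  shows "inj h"
proof (rule injI)
  fix x y assume "h x = h y"
  then have "m * norm (x - y) \<le> 0" using assms(2)[of x y] by simp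
  then show "x = y" using assms(1) by (simp add: mult_le_0_iff)
qed

text \<open>The range is open by invariance of domain and closed since \<open>h\<close> is expansive.\<close>

lemma expansive_imp_surj:
  fixes h :: "'a::euclidean_space \<Rightarrow> 'a"
  assumes cont: "continuous_on UNIV h" and m: "0 < m"
    and expand: "\<And>x y. m * norm (x - y) \<le> norm (h x - h y)"
  shows "surj h"
proof -
  have "open (range h)"
    using invariance_of_domain[of UNIV h] expansive_imp_inj[of m h] assms by auto
  moreover have "closed (range h)"
    unfolding closed_sequential_limits
  proof (intro allI impI, elim conjE)
    fix s y assume s: "\<forall>n. s n \<in> range h" and y: "s \<longlonglongrightarrow> y"
    have C: "Cauchy s" using y by (rule LIMSEQ_imp_Cauchy)
    from s have "\<forall>n. \<exists>x. s n = h x" by auto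
    then obtain t where t: "\<And>n. s n = h (t n)" by metis
    have "Cauchy t"
    proof (rule metric_CauchyI)
      fix e :: real assume "0 < e"
      then have "0 < m * e" using m by simp
      then obtain M where M: "\<And>i j. i \<ge> M \<Longrightarrow> j \<ge> M \<Longrightarrow> dist (s i) (s j) < m * e"
        using metric_CauchyD[OF C] by blast
      have "dist (t i) (t j) < e" if "i \<ge> M" "j \<ge> M" for i j
      proof -
        have "m * norm (t i - t j) < m * e"
          using expand[of "t i" "t j"] M[OF that] by (simp add: t dist_norm)
        then show ?thesis using m by (simp add: dist_norm)
      qed
      then show "\<exists>M. \<forall>i\<ge>M. \<forall>j\<ge>M. dist (t i) (t j) < e" by blast
    qed
    then obtain l where "t \<longlonglongrightarrow> l" using Cauchy_convergent convergent_def by blast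
    then have "(\<lambda>n. h (t n)) \<longlonglongrightarrow> h l"
      using cont by (auto intro!: continuous_on_tendsto_compose[of UNIV h])
    moreover have "s = (\<lambda>n. h (t n))" using t by auto
    ultimately have "s \<longlonglongrightarrow> h l" by simp
    then show "y \<in> range h" using LIMSEQ_unique[OF y] by auto
  qed
  ultimately show ?thesis
    using clopen[of "range h"] by auto
qed

context
  fixes f :: "real^'n \<Rightarrow> real^'n" and \<mu> \<theta> \<Delta> :: real
  assumes cont_f: "continuous_on UNIV f"
    and one_sided: "\<And>x y. (x - y) \<bullet> (f x - f y) \<le> \<mu> * (norm (x - y))\<^sup>2"
    and step_size: "0 \<le> \<theta> * \<Delta>" "\<theta> * \<Delta> * \<mu> \<le> 1/2"
begin

text \<open>As \<open>\<theta> * \<Delta> * \<mu> \<le> 1/2\<close>, the implicit term costs the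
  identity at most half of its strong monotonicity. The constant 1/2 does not depend on
  \<open>\<Delta>\<close>, which keeps later bounds uniform.\<close>

lemma implicit_map_expansive:
  "1/2 * norm (x - y) \<le> norm ((x - (\<theta> * \<Delta>) *\<^sub>R f x) - (y - (\<theta> * \<Delta>) *\<^sub>R f y))"
proof (rule strongly_monotone_expansive)
  have "(\<theta> * \<Delta>) * ((x - y) \<bullet> (f x - f y)) \<le> (\<theta> * \<Delta>) * (\<mu> * (norm (x - y))\<^sup>2)"
    by (intro mult_left_mono one_sided step_size)
  also have "\<dots> \<le> 1/2 * (norm (x - y))\<^sup>2"
    using mult_right_mono[OF step_size(2), of "(norm (x - y))\<^sup>2"] by (simp add: mult_ac)
  finally show "1/2 * (norm (x - y))\<^sup>2
      \<le> (x - y) \<bullet> ((x - (\<theta> * \<Delta>) *\<^sub>R f x) - (y - (\<theta> * \<Delta>) *\<^sub>R f y))"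
    by (simp add: power2_norm_eq_inner algebra_simps)
qed

text \<open>The expansive map is a bijection, so the \<open>THE\<close> in the definition is well
  defined and can be used as an equation in both directions.\<close>

lemma implicit_solution_iff: "implicit_solution f \<theta> \<Delta> z = y \<longleftrightarrow> y = z + (\<theta> * \<Delta>) *\<^sub>R f y"
proof -
  let ?h = "\<lambda>x. x - (\<theta> * \<Delta>) *\<^sub>R f x"
  have "inj ?h"
    by (rule expansive_imp_inj[of "1/2"]) (use implicit_map_expansive in auto)
  moreover have "surj ?h"
    by (rule expansive_imp_surj[of _ "1/2"])
       (use implicit_map_expansive in \<open>auto intro!: continuous_intros cont_f\<close>)
  ultimately have "bij ?h" by (rule bijI)
  then have "\<exists>!y. ?h y = z" by (simp only: bij_iff)
  moreover have "?h y = z \<longleftrightarrow> y = z + (\<theta> * \<Delta>) *\<^sub>R f y" for y by (auto simp: algebra_simps)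
  ultimately have ex1: "\<exists>!y. y = z + (\<theta> * \<Delta>) *\<^sub>R f y" by simp
  show ?thesis
    unfolding implicit_solution_def using theI'[OF ex1] the1_equality[OF ex1, of y] by metis
qed

lemma implicit_solution_eq:
  "implicit_solution f \<theta> \<Delta> z = z + (\<theta> * \<Delta>) *\<^sub>R f (implicit_solution f \<theta> \<Delta> z)"
  using implicit_solution_iff by blast

text \<open>The solution map inverts a map that expands with factor 1/2; hence the factor 2.\<close>

lemma implicit_solution_lipschitz:
  "norm (implicit_solution f \<theta> \<Delta> x - implicit_solution f \<theta> \<Delta> y) \<le> 2 * norm (x - y)"
proof -
  have "implicit_solution f \<theta> \<Delta> z - (\<theta> * \<Delta>) *\<^sub>R f (implicit_solution f \<theta> \<Delta> z) = z" for z
    using implicit_solution_eq[of z] by (simp add: algebra_simps)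
  then show ?thesis
    using implicit_map_expansive[of "implicit_solution f \<theta> \<Delta> x" "implicit_solution f \<theta> \<Delta> y"] by simp
qed

lemma continuous_implicit_solution: "continuous_on UNIV (implicit_solution f \<theta> \<Delta>)"
  by (rule lipschitz_on_continuous_on[of 2])
     (auto intro!: lipschitz_onI simp: dist_norm implicit_solution_lipschitz)

text \<open>The solution is compared with an explicit one: the datum
  \<open>- (\<theta> * \<Delta>) *\<^sub>R f 0\<close> has solution 0.\<close>

lemma norm_implicit_solution_le:
  "norm (implicit_solution f \<theta> \<Delta> z) \<le> 2 * norm z + 2 * (\<theta> * \<Delta>) * norm (f 0)"
proof -
  have "implicit_solution f \<theta> \<Delta> (- (\<theta> * \<Delta>) *\<^sub>R f 0) = 0"
    by (simp add: implicit_solution_iff)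
  then have "norm (implicit_solution f \<theta> \<Delta> z) \<le> 2 * norm (z + (\<theta> * \<Delta>) *\<^sub>R f 0)"
    using implicit_solution_lipschitz[of z "- (\<theta> * \<Delta>) *\<^sub>R f 0"] by simp
  also have "norm (z + (\<theta> * \<Delta>) *\<^sub>R f 0) \<le> norm z + (\<theta> * \<Delta>) * norm (f 0)"
    using norm_triangle_ineq[of z "(\<theta> * \<Delta>) *\<^sub>R f 0"] step_size by simp
  finally show ?thesis by simp
qed

end

subsection \<open>Pathwise estimates\<close>

text \<open>A pathwise form of Doob's \<open>L\<^sup>2\<close> maximal inequality: for a nonnegative submartingale the sum
  on the left has nonnegative expectation.\<close>

lemma pathwise_doob:
  fixes s :: "nat \<Rightarrow> real"
  defines "m \<equiv> \<lambda>n. Max (s ` {..n})"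
  shows "(m n)\<^sup>2 + 4 * (\<Sum>i<n. m i * (s (Suc i) - s i)) \<le> 4 * (s n)\<^sup>2"
proof -
  have m_Suc: "m (Suc n) = max (s (Suc n)) (m n)" for n
    unfolding m_def by (simp add: atMost_Suc)
  \<comment> \<open>While the maximum is unchanged, both sides grow by the same amount; at a new
    record the right side gains an extra \<open>(s (Suc n) - m n)\<^sup>2 / 2\<close>.\<close>
  have "(\<Sum>i<n. m i * (s (Suc i) - s i)) \<le> m n * s n - (m n)\<^sup>2 / 2"
  proof (induction n)
    case 0
    then show ?case by (simp add: m_def power2_eq_square)
  next
    case (Suc n)
    show ?case
    proof (cases "s (Suc n) \<le> m n")
      case True
      then show ?thesis using Suc by (simp add: m_Suc algebra_simps)
    next
      case False
      then have "m (Suc n) = s (Suc n)" by (simp add: m_Suc)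
      moreover have "0 \<le> (s (Suc n) - m n)\<^sup>2" by simp
      ultimately show ?thesis using Suc by (simp add: algebra_simps power2_eq_square)
    qed
  qed
  \<comment> \<open>Young's inequality: \<open>4 * m n * s n\<close> is at most
    \<open>(m n)\<^sup>2 + 4 * (s n)\<^sup>2\<close>.\<close>
  moreover have "0 \<le> (m n - 2 * s n)\<^sup>2" by simp
  ultimately show ?thesis by (simp add: algebra_simps power2_eq_square)
qed

text \<open>Here \<open>\<epsilon>\<^sup>2\<close> is the time step, \<open>v\<close> a standard normal increment, and \<open>V'\<close> the successor of \<open>V\<close>.\<close>

definition noise_step :: "real \<Rightarrow> nat \<Rightarrow> real \<Rightarrow> real \<Rightarrow> real \<Rightarrow> real \<Rightarrow> real \<Rightarrow> bool" where
  "noise_step C r \<epsilon> v V H V' \<longleftrightarrow>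
     0 \<le> V \<and> \<bar>H\<bar> \<le> C * V \<and> \<bar>V' - V - \<epsilon> * v * H\<bar> \<le> C * \<epsilon>\<^sup>2 * V * (1 + v\<^sup>2) ^ r"

lemma sum_squares_bound2: "(a + b)\<^sup>2 \<le> 2 * a\<^sup>2 + 2 * (b::real)\<^sup>2"
  using zero_le_power2[of "a - b"] by (simp add: power2_eq_square algebra_simps)

text \<open>With remainder \<open>R\<close>, the new remainder is
  \<open>2 * V * R + (\<epsilon> * v * H + R)\<^sup>2\<close>, and every term is of order
  \<open>\<epsilon>\<^sup>2\<close>. In the exponent, \<open>2 * r\<close> accommodates
  \<open>R\<^sup>2\<close> and the additional 1 the factor \<open>v\<^sup>2\<close>;
  \<open>E\<close> absorbs the surplus \<open>\<epsilon>\<^sup>2\<close> coming from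
  \<open>R\<^sup>2\<close>.\<close>

lemma noise_step_square:
  assumes step: "noise_step C r \<epsilon> v V H V'" and C: "0 \<le> C" and E: "\<epsilon>\<^sup>2 \<le> E"
  shows "noise_step (2 * C + 2 * C\<^sup>2 + 2 * C\<^sup>2 * E) (2 * r + 1) \<epsilon> v (V\<^sup>2) (2 * H * V) (V'\<^sup>2)"
proof -
  define C' where "C' = 2 * C + 2 * C\<^sup>2 + 2 * C\<^sup>2 * E"
  define q where "q = (1 + v\<^sup>2) ^ r"
  define Q where "Q = (1 + v\<^sup>2) ^ (2 * r + 1)"
  define R where "R = V' - V - \<epsilon> * v * H"
  have V: "0 \<le> V" and H: "\<bar>H\<bar> \<le> C * V" and R: "\<bar>R\<bar> \<le> C * \<epsilon>\<^sup>2 * V * q"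
    using step by (auto simp: noise_step_def q_def R_def)
  have E0: "0 \<le> E" using E zero_le_power2 order_trans by blast
  have q1: "1 \<le> q" by (simp add: q_def one_le_power)
  have Q_eq: "Q = q\<^sup>2 * (1 + v\<^sup>2)" by (simp only: Q_def q_def power_add power_even_eq power_one_right)
  have qq: "q \<le> q\<^sup>2" "1 \<le> q\<^sup>2"
    using mult_left_mono[OF q1, of q] q1 one_le_power[OF q1, of 2] by (auto simp: power2_eq_square)
  have q2Q: "q\<^sup>2 \<le> Q" unfolding Q_eq by (simp add: distrib_left)
  have qQ: "q \<le> Q" using qq q2Q by linarith
  have vQ: "v\<^sup>2 \<le> Q"
  proof -
    have "1 * (1 + v\<^sup>2) \<le> q\<^sup>2 * (1 + v\<^sup>2)" by (intro mult_right_mono qq) simp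
    then show ?thesis by (simp add: Q_eq)
  qed
  have Q0: "0 \<le> Q" using qQ q1 by linarith
  have HV: "\<bar>2 * H * V\<bar> \<le> C' * V\<^sup>2"
  proof -
    have "\<bar>2 * H * V\<bar> = 2 * (\<bar>H\<bar> * V)" using V by (simp add: abs_mult)
    also have "\<dots> \<le> 2 * (C * V * V)" using H V by (intro mult_left_mono mult_right_mono) auto
    also have "\<dots> \<le> C' * V\<^sup>2"
      using C E0 by (simp add: C'_def power2_eq_square algebra_simps)
    finally show ?thesis .
  qed
  have "V'\<^sup>2 - V\<^sup>2 - \<epsilon> * v * (2 * H * V) = 2 * V * R + (\<epsilon> * v * H + R)\<^sup>2"
    by (simp add: R_def power2_eq_square algebra_simps)
  also have "\<bar>\<dots>\<bar> \<le> 2 * V * \<bar>R\<bar> + (2 * (\<epsilon> * v * H)\<^sup>2 + 2 * R\<^sup>2)"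
    using sum_squares_bound2[of "\<epsilon> * v * H" R] V
    by (intro order_trans[OF abs_triangle_ineq] add_mono) (auto simp: abs_mult)
  also have "\<dots> \<le> 2 * V * (C * \<epsilon>\<^sup>2 * V * q) + (2 * (\<epsilon>\<^sup>2 * v\<^sup>2 * (C * V)\<^sup>2) + 2 * (C * \<epsilon>\<^sup>2 * V * q)\<^sup>2)"
  proof (intro add_mono mult_left_mono)
    show "(\<epsilon> * v * H)\<^sup>2 \<le> \<epsilon>\<^sup>2 * v\<^sup>2 * (C * V)\<^sup>2"
      unfolding power_mult_distrib[of "\<epsilon> * v"] power_mult_distrib[of \<epsilon>]
      using H power_mono[OF H abs_ge_zero, of 2] by (intro mult_left_mono) auto
    show "R\<^sup>2 \<le> (C * \<epsilon>\<^sup>2 * V * q)\<^sup>2" using power_mono[OF R abs_ge_zero, of 2] by simp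
  qed (use R V in auto)
  also have "\<dots> = \<epsilon>\<^sup>2 * V\<^sup>2 * (2 * C * q + 2 * C\<^sup>2 * v\<^sup>2 + 2 * C\<^sup>2 * \<epsilon>\<^sup>2 * q\<^sup>2)"
    by (simp add: power2_eq_square algebra_simps)
  also have "\<dots> \<le> \<epsilon>\<^sup>2 * V\<^sup>2 * (2 * C * Q + 2 * C\<^sup>2 * Q + 2 * C\<^sup>2 * E * Q)"
    using C E E0 Q0 qQ vQ q2Q by (intro mult_left_mono add_mono mult_mono) auto
  also have "\<dots> = C' * \<epsilon>\<^sup>2 * V\<^sup>2 * Q" by (simp add: C'_def algebra_simps)
  finally show ?thesis
    unfolding noise_step_def C'_def[symmetric] Q_def[symmetric] using HV by auto
qed

text \<open>Induction by squaring. \<open>C'\<close> and \<open>r'\<close> are fixed before the step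
  data, hence uniform in the step size; the new noise coefficient is the chain rule for the power
  \<open>2 ^ j\<close>.\<close>

lemma noise_step_power:
  assumes "0 \<le> C"
  shows "\<exists>C' r'. 0 \<le> C' \<and> (\<forall>\<epsilon> v V H V'. \<epsilon>\<^sup>2 \<le> E \<longrightarrow> noise_step C r \<epsilon> v V H V' \<longrightarrow>
    noise_step C' r' \<epsilon> v (V ^ 2 ^ j) (2 ^ j * H * V ^ (2 ^ j - 1)) (V' ^ 2 ^ j))"
proof (induction j)
  case 0
  then show ?case using assms by (intro exI[of _ C] exI[of _ r]) simp
next
  case (Suc j)
  then obtain C' r' where C': "0 \<le> C'" and
    step: "\<And>\<epsilon> v V H V'. \<epsilon>\<^sup>2 \<le> E \<Longrightarrow> noise_step C r \<epsilon> v V H V' \<Longrightarrow>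
      noise_step C' r' \<epsilon> v (V ^ 2 ^ j) (2 ^ j * H * V ^ (2 ^ j - 1)) (V' ^ 2 ^ j)" by blast
  \<comment> \<open>The absolute values give nonnegativity for any \<open>E\<close>; once
    \<open>\<epsilon>\<^sup>2 \<le> E\<close> they change nothing.\<close>
  define C'' where "C'' = \<bar>2 * C' + 2 * C'\<^sup>2 + 2 * C'\<^sup>2 * \<bar>E\<bar>\<bar>"
  have "noise_step C'' (2 * r' + 1) \<epsilon> v (V ^ 2 ^ Suc j) (2 ^ Suc j * H * V ^ (2 ^ Suc j - 1)) (V' ^ 2 ^ Suc j)"
    if "\<epsilon>\<^sup>2 \<le> E" "noise_step C r \<epsilon> v V H V'" for \<epsilon> v V H V'
  proof -
    have "(2::nat) ^ Suc j - 1 = (2 ^ j - 1) + 2 ^ j" by (simp add: mult_2)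
    then have "V ^ (2 ^ Suc j - 1) = V ^ (2 ^ j - 1) * V ^ 2 ^ j"
      by (metis power_add)
    then have "2 ^ Suc j * H * V ^ (2 ^ Suc j - 1) = 2 * (2 ^ j * H * V ^ (2 ^ j - 1)) * V ^ 2 ^ j"
      by simp
    moreover have "x ^ 2 ^ Suc j = (x ^ 2 ^ j)\<^sup>2" for x :: real
      by (simp add: power_mult[symmetric] mult.commute)
    moreover have "C'' = 2 * C' + 2 * C'\<^sup>2 + 2 * C'\<^sup>2 * E"
      using C' order_trans[OF zero_le_power2 that(1)] unfolding C''_def by simp
    ultimately show ?thesis
      using noise_step_square[OF step[OF that] C' that(1)] by metis
  qed
  then show ?case by (intro exI[of _ C''] exI[of _ "2 * r' + 1"]) (auto simp: C''_def)
qed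

text \<open>With \<open>a = 1 + |z|\<^sup>2\<close>, the bounds \<open>B * sqrt a\<close> express linear growth in \<open>z\<close>.\<close>

lemma noise_step_milstein:
  fixes z F G L :: "'a::real_inner"
  defines "a \<equiv> 1 + (norm z)\<^sup>2"
  assumes B: "0 \<le> B" and F: "norm F \<le> B * sqrt a" and G: "norm G \<le> B * sqrt a"
    and L: "norm L \<le> B * sqrt a" and E: "\<epsilon>\<^sup>2 \<le> E"
  shows "noise_step (4 * B + 2 * B\<^sup>2 + 8 * B\<^sup>2 * E) 2 \<epsilon> v a (2 * (z \<bullet> G))
    (1 + (norm (z + \<epsilon>\<^sup>2 *\<^sub>R F + (\<epsilon> * v) *\<^sub>R G + (1/2 * ((\<epsilon> * v)\<^sup>2 - \<epsilon>\<^sup>2)) *\<^sub>R L))\<^sup>2)"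
proof -
  \<comment> \<open>\<open>P\<close> gathers the terms of order \<open>\<epsilon>\<^sup>2\<close>:
    the drift and the Milstein correction. Its norm is bounded linearly in \<open>q\<close>, so its
    square is the origin of the exponent 2.\<close>
  define P where "P = F + (1/2 * (v\<^sup>2 - 1)) *\<^sub>R L"
  define q where "q = 1 + v\<^sup>2"
  define s where "s = sqrt a"
  have a1: "1 \<le> a" by (simp add: a_def)
  have s2: "s\<^sup>2 = a" and s0: "0 \<le> s" using a1 by (auto simp: s_def)
  have q1: "1 \<le> q" "v\<^sup>2 \<le> q" by (auto simp: q_def)
  have qq: "q \<le> q\<^sup>2" using mult_left_mono[OF q1(1), of q] q1 by (simp add: power2_eq_square)
  have E0: "0 \<le> E" using E zero_le_power2 order_trans by blast
  have zs: "norm z \<le> s" unfolding s_def by (rule real_le_rsqrt) (simp add: a_def)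
  have P: "norm P \<le> 2 * B * s * q"
  proof -
    have "\<bar>1/2 * (v\<^sup>2 - 1)\<bar> \<le> q"
      unfolding q_def abs_le_iff using zero_le_power2[of v] by (simp add: field_simps)
    then have "norm ((1/2 * (v\<^sup>2 - 1)) *\<^sub>R L) \<le> q * (B * s)"
      unfolding norm_scaleR using L by (intro mult_mono) (auto simp: s_def)
    moreover have "norm F \<le> q * (B * s)"
      using F B s0 q1 mult_right_mono[OF q1(1), of "B * s"] by (simp add: s_def)
    ultimately show ?thesis
      unfolding P_def using norm_triangle_ineq[of F "(1/2 * (v\<^sup>2 - 1)) *\<^sub>R L"] by (simp add: mult_ac)
  qed
  have "\<bar>z \<bullet> G\<bar> \<le> s * (B * s)"
    using Cauchy_Schwarz_ineq2[of z G] mult_mono[OF zs G s0] by (simp add: s_def)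
  then have zG: "\<bar>2 * (z \<bullet> G)\<bar> \<le> 2 * B * a" by (simp add: s2[symmetric] power2_eq_square abs_mult mult_ac)
  have "\<bar>z \<bullet> P\<bar> \<le> s * (2 * B * s * q)"
    using Cauchy_Schwarz_ineq2[of z P] mult_mono[OF zs P s0] by simp
  then have zP: "\<bar>z \<bullet> P\<bar> \<le> 2 * B * a * q" by (simp add: s2[symmetric] power2_eq_square mult_ac)
  have sq: "(norm ((\<epsilon> * v) *\<^sub>R G + \<epsilon>\<^sup>2 *\<^sub>R P))\<^sup>2 \<le> 2 * (\<epsilon>\<^sup>2 * v\<^sup>2 * (B\<^sup>2 * a)) + 2 * (\<epsilon>\<^sup>2 * \<epsilon>\<^sup>2 * (4 * B\<^sup>2 * a * q\<^sup>2))"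
  proof -
    have "(norm ((\<epsilon> * v) *\<^sub>R G + \<epsilon>\<^sup>2 *\<^sub>R P))\<^sup>2 \<le> (norm ((\<epsilon> * v) *\<^sub>R G) + norm (\<epsilon>\<^sup>2 *\<^sub>R P))\<^sup>2"
      by (intro power_mono norm_triangle_ineq) simp
    also have "\<dots> \<le> 2 * (norm ((\<epsilon> * v) *\<^sub>R G))\<^sup>2 + 2 * (norm (\<epsilon>\<^sup>2 *\<^sub>R P))\<^sup>2"
      by (rule sum_squares_bound2)
    also have "\<dots> = 2 * (\<epsilon>\<^sup>2 * v\<^sup>2 * (norm G)\<^sup>2) + 2 * (\<epsilon>\<^sup>2 * \<epsilon>\<^sup>2 * (norm P)\<^sup>2)"
      by (simp add: power_mult_distrib power2_eq_square abs_mult mult_ac)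
    also have "\<dots> \<le> 2 * (\<epsilon>\<^sup>2 * v\<^sup>2 * (B * s)\<^sup>2) + 2 * (\<epsilon>\<^sup>2 * \<epsilon>\<^sup>2 * (2 * B * s * q)\<^sup>2)"
      using G P by (intro add_mono mult_left_mono power_mono) (auto simp: s_def)
    finally show ?thesis by (simp add: power_mult_distrib s2 mult_ac)
  qed
  have z': "z + \<epsilon>\<^sup>2 *\<^sub>R F + (\<epsilon> * v) *\<^sub>R G + (1/2 * ((\<epsilon> * v)\<^sup>2 - \<epsilon>\<^sup>2)) *\<^sub>R L
      = z + ((\<epsilon> * v) *\<^sub>R G + \<epsilon>\<^sup>2 *\<^sub>R P)"
    by (simp add: P_def power_mult_distrib algebra_simps)
  \<comment> \<open>Expanding the square, the part linear in the noise is exactly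
    \<open>\<epsilon> * v * (2 * (z \<bullet> G))\<close>; what is left is of order
    \<open>\<epsilon>\<^sup>2\<close>.\<close>
  moreover have "(1 + (norm (z + ((\<epsilon> * v) *\<^sub>R G + \<epsilon>\<^sup>2 *\<^sub>R P)))\<^sup>2) - a - \<epsilon> * v * (2 * (z \<bullet> G))
      = 2 * \<epsilon>\<^sup>2 * (z \<bullet> P) + (norm ((\<epsilon> * v) *\<^sub>R G + \<epsilon>\<^sup>2 *\<^sub>R P))\<^sup>2"
    unfolding a_def power2_norm_eq_inner by (simp add: algebra_simps inner_commute)
  moreover have "\<bar>2 * \<epsilon>\<^sup>2 * (z \<bullet> P) + (norm ((\<epsilon> * v) *\<^sub>R G + \<epsilon>\<^sup>2 *\<^sub>R P))\<^sup>2\<bar>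
      \<le> (4 * B + 2 * B\<^sup>2 + 8 * B\<^sup>2 * E) * \<epsilon>\<^sup>2 * a * q\<^sup>2"
  proof -
    have "\<bar>2 * \<epsilon>\<^sup>2 * (z \<bullet> P) + (norm ((\<epsilon> * v) *\<^sub>R G + \<epsilon>\<^sup>2 *\<^sub>R P))\<^sup>2\<bar>
        \<le> 2 * \<epsilon>\<^sup>2 * \<bar>z \<bullet> P\<bar> + (norm ((\<epsilon> * v) *\<^sub>R G + \<epsilon>\<^sup>2 *\<^sub>R P))\<^sup>2"
      by (intro order_trans[OF abs_triangle_ineq]) (simp add: abs_mult)
    also have "\<dots> \<le> 2 * \<epsilon>\<^sup>2 * (2 * B * a * q)
        + (2 * (\<epsilon>\<^sup>2 * v\<^sup>2 * (B\<^sup>2 * a)) + 2 * (\<epsilon>\<^sup>2 * \<epsilon>\<^sup>2 * (4 * B\<^sup>2 * a * q\<^sup>2)))"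
      by (intro add_mono mult_left_mono zP sq) auto
    also have "\<dots> = \<epsilon>\<^sup>2 * a * (4 * B * q + 2 * B\<^sup>2 * v\<^sup>2 + 8 * B\<^sup>2 * \<epsilon>\<^sup>2 * q\<^sup>2)"
      by (simp add: algebra_simps)
    also have "\<dots> \<le> \<epsilon>\<^sup>2 * a * (4 * B * q\<^sup>2 + 2 * B\<^sup>2 * q\<^sup>2 + 8 * B\<^sup>2 * E * q\<^sup>2)"
      using B E E0 q1 qq a1 by (intro mult_left_mono add_mono mult_right_mono mult_mono) auto
    finally show ?thesis by (simp add: algebra_simps)
  qed
  moreover have "\<bar>2 * (z \<bullet> G)\<bar> \<le> (4 * B + 2 * B\<^sup>2 + 8 * B\<^sup>2 * E) * a"
  proof -
    have "2 * B * a \<le> (4 * B + 2 * B\<^sup>2 + 8 * B\<^sup>2 * E) * a"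
      using B E0 a1 by (intro mult_right_mono) auto
    then show ?thesis using zG by linarith
  qed
  ultimately show ?thesis
    unfolding noise_step_def q_def z' using a1 by auto
qed

subsection \<open>Maximal moment estimates\<close>

text \<open>The factor left when the remainder bound of \<open>noise_step\<close> is averaged over a
  standard normal \<open>v\<close>.\<close>

definition gauss_moment :: "nat \<Rightarrow> real" where
  "gauss_moment r = (\<integral>x. std_normal_density x * (1 + x\<^sup>2) ^ r \<partial>lborel)"

text \<open>The binomial theorem reduces the integrand to even moments of the normal
  density.\<close>

lemma integrable_gauss_moment: "integrable lborel (\<lambda>x. std_normal_density x * (1 + x\<^sup>2) ^ r)"
proof -
  have "(\<lambda>x. std_normal_density x * (1 + x\<^sup>2) ^ r)
      = (\<lambda>x. \<Sum>i\<le>r. real (r choose i) * (std_normal_density x * x\<^sup>2 ^ (r - i)))"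
    by (simp add: binomial_ring[of 1] sum_distrib_left mult_ac)
  moreover have "integrable lborel (\<lambda>x. std_normal_density x * x\<^sup>2 ^ i)" for i
    using integrable_std_normal_moment[of "2 * i"] by (simp only: power_mult)
  ultimately show ?thesis by simp
qed

lemma gauss_moment_nonneg: "0 \<le> gauss_moment r"
  unfolding gauss_moment_def by (rule integral_nonneg_AE) simp

text \<open>Discrete-time abstraction of the normalised Brownian increments: \<open>G k\<close> is
  the information available before step \<open>k\<close>, and \<open>v k\<close> drives that
  step.\<close>

locale gaussian_noise = prob_space M
  for M :: "'a measure" +
  fixes G :: "nat \<Rightarrow> 'a measure" and v :: "nat \<Rightarrow> 'a \<Rightarrow> real"
  assumes subalgebra_G: "subalgebra M (G k)"
    and G_mono_Suc: "sets (G k) \<subseteq> sets (G (Suc k))"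
    and indep_noise: "indep_set (sets (G k)) {v k -` A \<inter> space M | A. A \<in> sets borel}"
    and std_normal_noise: "distributed M lborel (v k) std_normal_density"
begin

lemma measurable_G_imp_M: "X \<in> measurable (G k) N \<Longrightarrow> X \<in> measurable M N"
  using measurable_from_subalg[OF subalgebra_G] by blast

lemma measurable_G_mono:
  assumes "i \<le> k" "X \<in> measurable (G i) N"
  shows "X \<in> measurable (G k) N"
proof -
  have "sets (G i) \<subseteq> sets (G k)" using lift_Suc_mono_le[of "\<lambda>i. sets (G i)"] G_mono_Suc assms(1) by blast
  moreover have "space (G i) = space (G k)" using subalgebra_G unfolding subalgebra_def by metis
  ultimately have "subalgebra (G k) (G i)" by (simp add: subalgebra_def)
  then show ?thesis using measurable_from_subalg assms(2) by blast
qed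

lemma measurable_noise [measurable]: "v k \<in> borel_measurable M"
  using std_normal_noise[of k] by (auto simp: distributed_def)

lemma
  assumes h: "h \<in> borel_measurable borel"
  shows integrable_noise_iff:
      "integrable M (\<lambda>\<omega>. h (v k \<omega>)) \<longleftrightarrow> integrable lborel (\<lambda>x. std_normal_density x * h x)" (is ?A)
    and expectation_noise:
      "(\<integral>\<omega>. h (v k \<omega>) \<partial>M) = (\<integral>x. std_normal_density x * h x \<partial>lborel)" (is ?B)
  using h distributed_integrable[OF std_normal_noise[of k], of h]
    distributed_integral[OF std_normal_noise[of k], of h] by auto

text \<open>Takes the place of conditioning on \<open>G k\<close>: a factor known before step
  \<open>k\<close> is independent of any function of \<open>v k\<close>, so the expectation
  factorises.\<close>

lemma
  assumes X: "X \<in> borel_measurable (G k)" "integrable M X"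
    and h: "h \<in> borel_measurable borel" "integrable lborel (\<lambda>x. std_normal_density x * h x)"
  shows integrable_mult_noise: "integrable M (\<lambda>\<omega>. X \<omega> * h (v k \<omega>))"
    and expectation_mult_noise:
      "(\<integral>\<omega>. X \<omega> * h (v k \<omega>) \<partial>M) = (\<integral>\<omega>. X \<omega> \<partial>M) * (\<integral>x. std_normal_density x * h x \<partial>lborel)"
proof -
  have sp: "space (G k) = space M" using subalgebra_G[of k] by (simp add: subalgebra_def)
  have "indep_set (sets (G k)) {v k -` A \<inter> space M | A. A \<in> sets borel}" by (rule indep_noise)
  \<comment> \<open>\<open>indep_var\<close> is expressed by generated sigma-algebras; both families
    are intersection-stable, so independence extends to them.\<close>
  then have "indep_set (sigma_sets (space M) (sets (G k)))
      (sigma_sets (space M) {v k -` A \<inter> space M | A. A \<in> sets borel})"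
  proof (rule indep_set_sigma_sets)
    show "Int_stable (sets (G k))" by (auto simp: Int_stable_def)
    show "Int_stable {v k -` A \<inter> space M | A. A \<in> sets borel}"
    proof (rule Int_stableI)
      fix A B assume "A \<in> {v k -` A \<inter> space M | A. A \<in> sets borel}"
        and "B \<in> {v k -` A \<inter> space M | A. A \<in> sets borel}"
      then obtain A' B' where "A' \<in> sets borel" "B' \<in> sets borel"
        and "A \<inter> B = v k -` (A' \<inter> B') \<inter> space M" by auto
      then show "A \<inter> B \<in> {v k -` A \<inter> space M | A. A \<in> sets borel}" by blast
    qed
  qed
  then have 1: "indep_set (sets (G k)) (sigma_sets (space M) {v k -` A \<inter> space M | A. A \<in> sets borel})"
    using sets.sigma_sets_eq[of "G k"] sp by simp
  have "indep_set (sigma_sets (space M) {X -` A \<inter> space M | A. A \<in> sets borel})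
      (sigma_sets (space M) {v k -` A \<inter> space M | A. A \<in> sets borel})"
  proof -
    have "{X -` A \<inter> space M | A. A \<in> sets borel} \<subseteq> sets (G k)"
      using measurable_sets[OF X(1)] sp by auto
    then have "sigma_sets (space M) {X -` A \<inter> space M | A. A \<in> sets borel} \<subseteq> sets (G k)"
      using sets.sigma_sets_subset[of _ "G k"] sp by simp
    then show ?thesis
      unfolding indep_set_def
      by (intro indep_sets_mono_sets[OF 1[unfolded indep_set_def]]) (auto split: bool.split)
  qed
  then have "indep_var borel X borel (v k)"
    unfolding indep_var_eq using measurable_G_imp_M[OF X(1)] by simp
  then have "indep_var borel (id \<circ> X) borel (h \<circ> v k)"
    using h(1) by (intro indep_var_compose) auto
  then have ind: "indep_var borel X borel (\<lambda>\<omega>. h (v k \<omega>))" by (simp add: comp_def)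
  have int: "integrable M (\<lambda>\<omega>. h (v k \<omega>))" using h integrable_noise_iff by blast
  show "integrable M (\<lambda>\<omega>. X \<omega> * h (v k \<omega>))" by (rule indep_var_integrable[OF ind X(2) int])
  show "(\<integral>\<omega>. X \<omega> * h (v k \<omega>) \<partial>M) = (\<integral>\<omega>. X \<omega> \<partial>M) * (\<integral>x. std_normal_density x * h x \<partial>lborel)"
    using indep_var_lebesgue_integral[OF ind X(2) int] expectation_noise[OF h(1)] by simp
qed

lemma integrable_mult_noise_linear:
  "X \<in> borel_measurable (G k) \<Longrightarrow> integrable M X \<Longrightarrow> integrable M (\<lambda>\<omega>. X \<omega> * v k \<omega>)"
  using integrable_mult_noise[of X k "\<lambda>x. x"] integrable_std_normal_moment[of 1] by simp

text \<open>The first normal moment vanishes, which removes the linear noise term from both the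
  upper and the lower drift estimate.\<close>

lemma expectation_mult_noise_linear:
  "X \<in> borel_measurable (G k) \<Longrightarrow> integrable M X \<Longrightarrow> (\<integral>\<omega>. X \<omega> * v k \<omega> \<partial>M) = 0"
  using expectation_mult_noise[of X k "\<lambda>x. x"] integrable_std_normal_moment[of 1]
    integral_std_normal_moment_odd[of 0] by simp

lemma integrable_mult_noise_moment:
  "X \<in> borel_measurable (G k) \<Longrightarrow> integrable M X \<Longrightarrow> integrable M (\<lambda>\<omega>. X \<omega> * (1 + (v k \<omega>)\<^sup>2) ^ r)"
  by (rule integrable_mult_noise[of X k "\<lambda>x. (1 + x\<^sup>2) ^ r"]) (auto intro: integrable_gauss_moment)

lemma expectation_mult_noise_moment:
  "X \<in> borel_measurable (G k) \<Longrightarrow> integrable M X \<Longrightarrow>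
    (\<integral>\<omega>. X \<omega> * (1 + (v k \<omega>)\<^sup>2) ^ r \<partial>M) = (\<integral>\<omega>. X \<omega> \<partial>M) * gauss_moment r"
  unfolding gauss_moment_def
  by (rule expectation_mult_noise[of X k "\<lambda>x. (1 + x\<^sup>2) ^ r"]) (auto intro: integrable_gauss_moment)

context
  fixes V H :: "nat \<Rightarrow> 'a \<Rightarrow> real" and C \<epsilon> :: real and r :: nat
  assumes V_meas: "\<And>k. V k \<in> borel_measurable (G k)"
    and H_meas: "\<And>k. H k \<in> borel_measurable (G k)"
    and step: "\<And>k \<omega>. noise_step C r \<epsilon> (v k \<omega>) (V k \<omega>) (H k \<omega>) (V (Suc k) \<omega>)"
begin

text \<open>By the upper bound in \<open>noise_step\<close>, one step multiplies the mean by at most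
  \<open>1 + C * \<epsilon>\<^sup>2 * gauss_moment r\<close>. Integrability is carried in the same
  induction because factorising the expectation presupposes it.\<close>

lemma noise_step_moment:
  assumes C: "0 \<le> C" and V0: "integrable M (V 0)"
  shows "integrable M (V k)"
    and "(\<integral>\<omega>. V k \<omega> \<partial>M) \<le> (1 + C * \<epsilon>\<^sup>2 * gauss_moment r) ^ k * (\<integral>\<omega>. V 0 \<omega> \<partial>M)"
proof (induction k)
  case 0
  show "integrable M (V 0)" by (rule V0)
  show "(\<integral>\<omega>. V 0 \<omega> \<partial>M) \<le> (1 + C * \<epsilon>\<^sup>2 * gauss_moment r) ^ 0 * (\<integral>\<omega>. V 0 \<omega> \<partial>M)" by simp
next
  case (Suc k)
  have "norm (H k \<omega>) \<le> norm (C * V k \<omega>)" for \<omega>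
    using step[of k \<omega>] C by (simp add: noise_step_def)
  then have Hint: "integrable M (H k)"
    using measurable_G_imp_M[OF H_meas[of k]]
    by (intro Bochner_Integration.integrable_bound[OF integrable_mult_right[OF Suc(1), of C]]) auto
  define U where "U = (\<lambda>\<omega>. V k \<omega> + \<epsilon> * (H k \<omega> * v k \<omega>) + C * \<epsilon>\<^sup>2 * (V k \<omega> * (1 + (v k \<omega>)\<^sup>2) ^ r))"
  have U: "integrable M U"
    unfolding U_def using Suc(1) integrable_mult_noise_linear[OF H_meas Hint]
      integrable_mult_noise_moment[OF V_meas Suc(1)] by simp
  \<comment> \<open>Nonnegativity of \<open>V (Suc k)\<close> is read off the step that starts
    there.\<close>
  have VU: "0 \<le> V (Suc k) \<omega>" "V (Suc k) \<omega> \<le> U \<omega>" for \<omega>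
    using step[of k \<omega>] step[of "Suc k" \<omega>] by (auto simp: noise_step_def U_def abs_le_iff algebra_simps)
  have "norm (V (Suc k) \<omega>) \<le> norm (U \<omega>)" for \<omega> using VU[of \<omega>] by simp
  then show int: "integrable M (V (Suc k))"
    using measurable_G_imp_M[OF V_meas] by (intro Bochner_Integration.integrable_bound[OF U]) auto
  have "(\<integral>\<omega>. V (Suc k) \<omega> \<partial>M) \<le> (\<integral>\<omega>. U \<omega> \<partial>M)"
    by (intro integral_mono int U VU)
  also have "\<dots> = (1 + C * \<epsilon>\<^sup>2 * gauss_moment r) * (\<integral>\<omega>. V k \<omega> \<partial>M)"
    unfolding U_def using Suc(1) integrable_mult_noise_linear[OF H_meas Hint]
      integrable_mult_noise_moment[OF V_meas Suc(1)]
      expectation_mult_noise_linear[OF H_meas Hint] expectation_mult_noise_moment[OF V_meas Suc(1)]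
    by simp (simp add: algebra_simps)
  also have "\<dots> \<le> (1 + C * \<epsilon>\<^sup>2 * gauss_moment r)
      * ((1 + C * \<epsilon>\<^sup>2 * gauss_moment r) ^ k * (\<integral>\<omega>. V 0 \<omega> \<partial>M))"
    using C gauss_moment_nonneg[of r] by (intro mult_left_mono Suc(2)) auto
  finally show "(\<integral>\<omega>. V (Suc k) \<omega> \<partial>M)
      \<le> (1 + C * \<epsilon>\<^sup>2 * gauss_moment r) ^ Suc k * (\<integral>\<omega>. V 0 \<omega> \<partial>M)" by simp
qed

end

lemma integrable_mult_of_squares:
  fixes X Y :: "'a \<Rightarrow> real"
  assumes "X \<in> borel_measurable M" "Y \<in> borel_measurable M"
    and "integrable M (\<lambda>\<omega>. (X \<omega>)\<^sup>2)" "integrable M (\<lambda>\<omega>. (Y \<omega>)\<^sup>2)"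
  shows "integrable M (\<lambda>\<omega>. X \<omega> * Y \<omega>)"
proof (rule Bochner_Integration.integrable_bound[of M "\<lambda>\<omega>. (X \<omega>)\<^sup>2 + (Y \<omega>)\<^sup>2"])
  have "\<bar>x * y\<bar> \<le> x\<^sup>2 + y\<^sup>2" for x y :: real
    using sum_squares_bound[of "\<bar>x\<bar>" "\<bar>y\<bar>"] zero_le_power2[of x] zero_le_power2[of y]
    unfolding abs_mult power2_abs by linarith
  then show "AE \<omega> in M. norm (X \<omega> * Y \<omega>) \<le> norm ((X \<omega>)\<^sup>2 + (Y \<omega>)\<^sup>2)" by simp
qed (use assms in auto)

text \<open>Adding \<open>\<kappa> * \<Sum>\<^bsub>j<k\<^esub> V j\<close> compensates the drift of \<open>V\<close> and produces a submartingale \<open>S\<close>.\<close>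

lemma noise_step_maximal:
  assumes V_meas: "\<And>k. V k \<in> borel_measurable (G k)"
    and H_meas: "\<And>k. H k \<in> borel_measurable (G k)"
    and step: "\<And>k \<omega>. noise_step C r \<epsilon> (v k \<omega>) (V k \<omega>) (H k \<omega>) (V (Suc k) \<omega>)"
    and C: "0 \<le> C" and V0: "integrable M (\<lambda>\<omega>. (V 0 \<omega>)\<^sup>2)"
    and T: "real N * \<epsilon>\<^sup>2 \<le> T" "\<epsilon>\<^sup>2 \<le> T"
  defines "C' \<equiv> 2 * C + 2 * C\<^sup>2 + 2 * C\<^sup>2 * T"
  shows "integrable M (\<lambda>\<omega>. (Max ((\<lambda>k. V k \<omega>) ` {..N}))\<^sup>2)" (is ?int)
    and "(\<integral>\<omega>. (Max ((\<lambda>k. V k \<omega>) ` {..N}))\<^sup>2 \<partial>M)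
      \<le> 8 * (1 + (C * gauss_moment r * T)\<^sup>2) * exp (C' * gauss_moment (2 * r + 1) * T)
        * (\<integral>\<omega>. (V 0 \<omega>)\<^sup>2 \<partial>M)" (is ?le)
proof -
  note MG = measurable_G_imp_M
  \<comment> \<open>By the lower bound in \<open>noise_step\<close>, the conditional drift of
    \<open>V\<close> is at least \<open>- \<kappa> * V k\<close>; \<open>S\<close> adds this loss
    back.\<close>
  define \<kappa> where "\<kappa> = C * \<epsilon>\<^sup>2 * gauss_moment r"
  define S where "S = (\<lambda>k \<omega>. V k \<omega> + \<kappa> * (\<Sum>j<k. V j \<omega>))"
  define m where "m = (\<lambda>k \<omega>. Max ((\<lambda>i. S i \<omega>) ` {..k}))"
  define D where "D = exp (C' * gauss_moment (2 * r + 1) * T) * (\<integral>\<omega>. (V 0 \<omega>)\<^sup>2 \<partial>M)"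
  have T0: "0 \<le> T" using T(2) zero_le_power2 order_trans by blast
  have C': "0 \<le> C'" unfolding C'_def using C T0 by simp
  have \<kappa>0: "0 \<le> \<kappa>" using C gauss_moment_nonneg by (simp add: \<kappa>_def)
  have V_nn: "0 \<le> V k \<omega>" and H_le: "\<bar>H k \<omega>\<bar> \<le> C * V k \<omega>" for k \<omega>
    using step[of k \<omega>] by (auto simp: noise_step_def)
  \<comment> \<open>The squared process again satisfies \<open>noise_step\<close>, so the
    first-moment bound applied to it controls second moments of \<open>V\<close>.\<close>
  have V2: "integrable M (\<lambda>\<omega>. (V k \<omega>)\<^sup>2)"
    and V2_le: "(\<integral>\<omega>. (V k \<omega>)\<^sup>2 \<partial>M) \<le> (1 + C' * \<epsilon>\<^sup>2 * gauss_moment (2 * r + 1)) ^ k * (\<integral>\<omega>. (V 0 \<omega>)\<^sup>2 \<partial>M)" for k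
    unfolding atomize_conj
    using noise_step_moment[of "\<lambda>k \<omega>. (V k \<omega>)\<^sup>2" "\<lambda>k \<omega>. 2 * H k \<omega> * V k \<omega>" C' "2 * r + 1" \<epsilon> k]
      noise_step_square[OF step C T(2)] V_meas H_meas C' V0
    by (auto simp: C'_def)
  have V2_D: "(\<integral>\<omega>. (V k \<omega>)\<^sup>2 \<partial>M) \<le> D" if "k \<le> N" for k
  proof -
    let ?x = "C' * gauss_moment (2 * r + 1)"
    have x: "0 \<le> ?x" using C' gauss_moment_nonneg by simp
    have "C' * \<epsilon>\<^sup>2 * gauss_moment (2 * r + 1) = ?x * \<epsilon>\<^sup>2" by simp
    \<comment> \<open>\<open>1 + x \<le> exp x\<close> turns geometric growth in the number of steps
      into exponential growth in elapsed time, which is at most \<open>T\<close>.\<close>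
    then have "(1 + C' * \<epsilon>\<^sup>2 * gauss_moment (2 * r + 1)) ^ k \<le> exp (?x * \<epsilon>\<^sup>2) ^ k"
      using mult_nonneg_nonneg[OF x zero_le_power2[of \<epsilon>]] exp_ge_add_one_self[of "?x * \<epsilon>\<^sup>2"]
      by (intro power_mono) linarith+
    also have "\<dots> = exp (?x * (real k * \<epsilon>\<^sup>2))"
      by (simp add: exp_of_nat_mult[symmetric] mult_ac)
    also have "\<dots> \<le> exp (?x * T)"
    proof -
      have "real k * \<epsilon>\<^sup>2 \<le> real N * \<epsilon>\<^sup>2" using that by (intro mult_right_mono) auto
      then show ?thesis using T(1) x by (auto intro!: mult_left_mono)
    qed
    finally show ?thesis
      unfolding D_def by (intro order_trans[OF V2_le] mult_right_mono) auto
  qed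
  have D0: "0 \<le> D" unfolding D_def by simp
  have "V j \<in> borel_measurable (G k)" if "j \<le> k" for j k
    using that V_meas by (rule measurable_G_mono)
  then have S_meas: "S k \<in> borel_measurable (G k)" for k
    unfolding S_def
    by (intro borel_measurable_add borel_measurable_times borel_measurable_sum) auto
  have SG: "S j \<in> borel_measurable (G k)" if "j \<le> k" for j k
    using that S_meas by (rule measurable_G_mono)
  have m_meas: "m k \<in> borel_measurable (G k)" for k
    unfolding m_def by (intro borel_measurable_Max) (auto intro: SG)
  have VS: "V k \<omega> \<le> S k \<omega>" for k \<omega>
    unfolding S_def using \<kappa>0 V_nn by (simp add: sum_nonneg)
  have S_nn: "0 \<le> S k \<omega>" for k \<omega> using V_nn[of k \<omega>] VS[of k \<omega>] by simp
  have m_nn: "0 \<le> m k \<omega>" for k \<omega>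
    unfolding m_def using S_nn[of 0 \<omega>] by (auto simp: Max_ge_iff)
  have S2_le: "(S k \<omega>)\<^sup>2 \<le> 2 * (V k \<omega>)\<^sup>2 + 2 * \<kappa>\<^sup>2 * (real k * (\<Sum>j<k. (V j \<omega>)\<^sup>2))" for k \<omega>
  proof -
    have "(S k \<omega>)\<^sup>2 \<le> 2 * (V k \<omega>)\<^sup>2 + 2 * \<kappa>\<^sup>2 * (\<Sum>j<k. V j \<omega>)\<^sup>2"
      using sum_squares_bound2[of "V k \<omega>" "\<kappa> * (\<Sum>j<k. V j \<omega>)"] by (simp add: S_def power_mult_distrib)
    \<comment> \<open>Cauchy-Schwarz for a sum of \<open>k\<close> terms. The factor
      \<open>real k\<close> and the number of summands are compensated later by
      \<open>\<kappa>\<^sup>2\<close>, of order \<open>\<epsilon> ^ 4\<close>.\<close>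
    also have "\<dots> \<le> 2 * (V k \<omega>)\<^sup>2 + 2 * \<kappa>\<^sup>2 * (real k * (\<Sum>j<k. (V j \<omega>)\<^sup>2))"
      using sum_squared_le_sum_of_squares[of "\<lambda>j. V j \<omega>" "{..<k}"]
      by (intro add_left_mono mult_left_mono) (auto simp: mult.commute)
    finally show ?thesis .
  qed
  have U2: "integrable M (\<lambda>\<omega>. 2 * (V k \<omega>)\<^sup>2 + 2 * \<kappa>\<^sup>2 * (real k * (\<Sum>j<k. (V j \<omega>)\<^sup>2)))" for k
    using V2 by simp
  have S2: "integrable M (\<lambda>\<omega>. (S k \<omega>)\<^sup>2)" for k
  proof (rule Bochner_Integration.integrable_bound[OF U2[of k]])
    show "(\<lambda>\<omega>. (S k \<omega>)\<^sup>2) \<in> borel_measurable M" using MG[OF S_meas] by simp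
    show "AE \<omega> in M. norm ((S k \<omega>)\<^sup>2)
        \<le> norm (2 * (V k \<omega>)\<^sup>2 + 2 * \<kappa>\<^sup>2 * (real k * (\<Sum>j<k. (V j \<omega>)\<^sup>2)))"
      using S2_le by (intro AE_I2) (simp add: sum_nonneg)
  qed
  have m2: "integrable M (\<lambda>\<omega>. (m k \<omega>)\<^sup>2)" for k
  proof (rule Bochner_Integration.integrable_bound)
    show "integrable M (\<lambda>\<omega>. \<Sum>i\<le>k. (S i \<omega>)\<^sup>2)" using S2 by simp
    show "(\<lambda>\<omega>. (m k \<omega>)\<^sup>2) \<in> borel_measurable M" using MG[OF m_meas] by simp
    have "(m k \<omega>)\<^sup>2 \<le> (\<Sum>i\<le>k. (S i \<omega>)\<^sup>2)" for \<omega>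
    proof -
      have "m k \<omega> \<in> (\<lambda>i. S i \<omega>) ` {..k}" unfolding m_def by (intro Max_in) auto
      then obtain i where "i \<le> k" "m k \<omega> = S i \<omega>" by auto
      then show ?thesis using member_le_sum[of i "{..k}" "\<lambda>i. (S i \<omega>)\<^sup>2"] by simp
    qed
    then show "AE \<omega> in M. norm ((m k \<omega>)\<^sup>2) \<le> norm (\<Sum>i\<le>k. (S i \<omega>)\<^sup>2)"
      by (intro AE_I2) (simp add: sum_nonneg)
  qed
  have MaxV: "0 \<le> Max ((\<lambda>k. V k \<omega>) ` {..N})" "Max ((\<lambda>k. V k \<omega>) ` {..N}) \<le> m N \<omega>" for \<omega>
  proof -
    show "0 \<le> Max ((\<lambda>k. V k \<omega>) ` {..N})" using V_nn[of 0 \<omega>] by (auto simp: Max_ge_iff)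
    have "V k \<omega> \<le> m N \<omega>" if "k \<le> N" for k
      using VS[of k \<omega>] that by (auto simp: m_def Max_ge_iff)
    then show "Max ((\<lambda>k. V k \<omega>) ` {..N}) \<le> m N \<omega>" by simp
  qed
  then have MaxV2: "(Max ((\<lambda>k. V k \<omega>) ` {..N}))\<^sup>2 \<le> (m N \<omega>)\<^sup>2" for \<omega>
    by (intro power_mono)
  have "(\<lambda>\<omega>. Max ((\<lambda>k. V k \<omega>) ` {..N})) \<in> borel_measurable M"
    using MG[OF V_meas] by (intro borel_measurable_Max) auto
  then show int: ?int
    by (intro Bochner_Integration.integrable_bound[OF m2[of N]]) (auto simp: MaxV2)
  \<comment> \<open>The submartingale property of \<open>S\<close>, tested against the weight
    \<open>m k\<close>, which is nonnegative and known before step \<open>k\<close>; these are the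
    terms of \<open>pathwise_doob\<close>.\<close>
  have drift: "integrable M (\<lambda>\<omega>. m k \<omega> * (S (Suc k) \<omega> - S k \<omega>))"
    "0 \<le> (\<integral>\<omega>. m k \<omega> * (S (Suc k) \<omega> - S k \<omega>) \<partial>M)" for k
  proof -
    show int: "integrable M (\<lambda>\<omega>. m k \<omega> * (S (Suc k) \<omega> - S k \<omega>))"
      unfolding right_diff_distrib
      by (intro Bochner_Integration.integrable_diff integrable_mult_of_squares MG[OF m_meas] MG[OF S_meas] m2 S2)
    have mV: "integrable M (\<lambda>\<omega>. m k \<omega> * V k \<omega>)"
      by (intro integrable_mult_of_squares MG[OF m_meas] MG[OF V_meas] m2 V2)
    have mV_meas: "(\<lambda>\<omega>. m k \<omega> * V k \<omega>) \<in> borel_measurable (G k)"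
      and mH_meas: "(\<lambda>\<omega>. m k \<omega> * H k \<omega>) \<in> borel_measurable (G k)"
      by (intro borel_measurable_times m_meas V_meas H_meas)+
    have mH: "integrable M (\<lambda>\<omega>. m k \<omega> * H k \<omega>)"
    proof (rule Bochner_Integration.integrable_bound)
      show "integrable M (\<lambda>\<omega>. C * (m k \<omega> * V k \<omega>))" using mV by simp
      show "AE \<omega> in M. norm (m k \<omega> * H k \<omega>) \<le> norm (C * (m k \<omega> * V k \<omega>))"
        using mult_left_mono[OF H_le m_nn] C m_nn V_nn by (intro AE_I2) (simp add: abs_mult mult_ac)
    qed (use MG[OF mH_meas] in auto)
    \<comment> \<open>A lower bound of the integrand with mean exactly zero: the noise term averages
      out, and \<open>\<kappa>\<close> equals the averaged coefficient of the subtracted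
      remainder.\<close>
    define L where "L = (\<lambda>\<omega>. \<epsilon> * (m k \<omega> * H k \<omega> * v k \<omega>)
      - C * \<epsilon>\<^sup>2 * (m k \<omega> * V k \<omega> * (1 + (v k \<omega>)\<^sup>2) ^ r) + \<kappa> * (m k \<omega> * V k \<omega>))"
    note ints = integrable_mult_noise_linear[OF mH_meas mH] integrable_mult_noise_moment[OF mV_meas mV] mV
    have "(\<integral>\<omega>. L \<omega> \<partial>M) = 0"
      unfolding L_def using ints
      by (simp add: expectation_mult_noise_linear[OF mH_meas mH]
          expectation_mult_noise_moment[OF mV_meas mV] \<kappa>_def)
    moreover have "integrable M L" unfolding L_def using ints by simp
    moreover have "L \<omega> \<le> m k \<omega> * (S (Suc k) \<omega> - S k \<omega>)" for \<omega>
    proof -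
      have "\<epsilon> * v k \<omega> * H k \<omega> - C * \<epsilon>\<^sup>2 * V k \<omega> * (1 + (v k \<omega>)\<^sup>2) ^ r + \<kappa> * V k \<omega> \<le> S (Suc k) \<omega> - S k \<omega>"
        using step[of k \<omega>] by (simp add: noise_step_def S_def abs_le_iff algebra_simps)
      from mult_left_mono[OF this m_nn[of k \<omega>]] show ?thesis
        by (simp add: L_def algebra_simps)
    qed
    ultimately show "0 \<le> (\<integral>\<omega>. m k \<omega> * (S (Suc k) \<omega> - S k \<omega>) \<partial>M)"
      using integral_mono[of M L "\<lambda>\<omega>. m k \<omega> * (S (Suc k) \<omega> - S k \<omega>)"] int by simp
  qed
  \<comment> \<open>Integrate \<open>pathwise_doob\<close> and discard the drift terms, whose means
    are nonnegative.\<close>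
  have "(\<integral>\<omega>. (m N \<omega>)\<^sup>2 \<partial>M) \<le> 4 * (\<integral>\<omega>. (S N \<omega>)\<^sup>2 \<partial>M)"
  proof -
    have "(\<integral>\<omega>. (m N \<omega>)\<^sup>2 \<partial>M)
        \<le> (\<integral>\<omega>. 4 * (S N \<omega>)\<^sup>2 - 4 * (\<Sum>i<N. m i \<omega> * (S (Suc i) \<omega> - S i \<omega>)) \<partial>M)"
      using m2 S2 drift(1) pathwise_doob[of "\<lambda>i. S i _" N]
      by (intro integral_mono) (auto simp: m_def algebra_simps)
    also have "\<dots> = 4 * (\<integral>\<omega>. (S N \<omega>)\<^sup>2 \<partial>M) - 4 * (\<Sum>i<N. \<integral>\<omega>. m i \<omega> * (S (Suc i) \<omega> - S i \<omega>) \<partial>M)"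
      using S2 drift(1) by simp
    also have "\<dots> \<le> 4 * (\<integral>\<omega>. (S N \<omega>)\<^sup>2 \<partial>M)" using drift(2) by (simp add: sum_nonneg)
    finally show ?thesis .
  qed
  moreover have "(\<integral>\<omega>. (S N \<omega>)\<^sup>2 \<partial>M) \<le> 2 * (1 + (C * gauss_moment r * T)\<^sup>2) * D"
  proof -
    have "(\<integral>\<omega>. (S N \<omega>)\<^sup>2 \<partial>M)
        \<le> (\<integral>\<omega>. 2 * (V N \<omega>)\<^sup>2 + 2 * \<kappa>\<^sup>2 * (real N * (\<Sum>j<N. (V j \<omega>)\<^sup>2)) \<partial>M)"
      by (intro integral_mono S2 U2 S2_le)
    also have "\<dots> = 2 * (\<integral>\<omega>. (V N \<omega>)\<^sup>2 \<partial>M) + 2 * \<kappa>\<^sup>2 * (real N * (\<Sum>j<N. \<integral>\<omega>. (V j \<omega>)\<^sup>2 \<partial>M))"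
      using V2 by simp
    also have "\<dots> \<le> 2 * D + 2 * \<kappa>\<^sup>2 * (real N * (\<Sum>j<N. D))"
      by (intro add_mono mult_left_mono sum_mono V2_D) auto
    also have "\<dots> = 2 * D + 2 * (\<kappa> * real N)\<^sup>2 * D"
      by (simp add: power2_eq_square mult_ac)
    also have "\<dots> \<le> 2 * D + 2 * (C * gauss_moment r * T)\<^sup>2 * D"
    proof -
      \<comment> \<open>The \<open>N\<close> compensators of order \<open>\<epsilon>\<^sup>2\<close>
        add up to elapsed time, so no dependence on \<open>N\<close> remains.\<close>
      have "\<kappa> * real N = C * gauss_moment r * (real N * \<epsilon>\<^sup>2)" by (simp add: \<kappa>_def mult_ac)
      also have "\<dots> \<le> C * gauss_moment r * T"
        using C gauss_moment_nonneg by (intro mult_left_mono T) auto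
      finally show ?thesis
        using \<kappa>0 D0 by (intro add_left_mono mult_right_mono mult_left_mono power_mono) auto
    qed
    finally show ?thesis by (simp add: algebra_simps)
  qed
  moreover have "(\<integral>\<omega>. (Max ((\<lambda>k. V k \<omega>) ` {..N}))\<^sup>2 \<partial>M) \<le> (\<integral>\<omega>. (m N \<omega>)\<^sup>2 \<partial>M)"
    by (intro integral_mono int m2 MaxV2)
  ultimately have "(\<integral>\<omega>. (Max ((\<lambda>k. V k \<omega>) ` {..N}))\<^sup>2 \<partial>M) \<le> 8 * (1 + (C * gauss_moment r * T)\<^sup>2) * D"
    by linarith
  then show ?le by (simp add: D_def mult.assoc)
qed

end

subsection \<open>The Milstein schemes\<close>

text \<open>Carries the maximal bound for \<open>V\<close> over to quantities dominated by its
  square: squaring is monotone on nonnegative values, so domination survives the maximum.\<close>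

lemma SUP_moment_bound:
  fixes X V :: "nat \<Rightarrow> 'a \<Rightarrow> real"
  assumes X: "\<And>k. X k \<in> borel_measurable M" "\<And>k \<omega>. 0 \<le> X k \<omega>" "\<And>k \<omega>. X k \<omega> \<le> c * (V k \<omega>)\<^sup>2"
    and V: "\<And>k \<omega>. 0 \<le> V k \<omega>" and c: "0 \<le> c"
    and int: "integrable M (\<lambda>\<omega>. (Max ((\<lambda>k. V k \<omega>) ` {..N}))\<^sup>2)"
  shows "integrable M (\<lambda>\<omega>. SUP k\<in>{..N}. X k \<omega>)"
    and "(\<integral>\<omega>. (SUP k\<in>{..N}. X k \<omega>) \<partial>M) \<le> c * (\<integral>\<omega>. (Max ((\<lambda>k. V k \<omega>) ` {..N}))\<^sup>2 \<partial>M)"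
proof -
  have Sup_Max: "(SUP k\<in>{..N}. X k \<omega>) = Max ((\<lambda>k. X k \<omega>) ` {..N})" for \<omega>
    by (rule cSup_eq_Max) auto
  have nn: "0 \<le> (SUP k\<in>{..N}. X k \<omega>)" for \<omega>
    unfolding Sup_Max using X(2)[of 0 \<omega>] by (auto simp: Max_ge_iff)
  have le: "(SUP k\<in>{..N}. X k \<omega>) \<le> c * (Max ((\<lambda>k. V k \<omega>) ` {..N}))\<^sup>2" for \<omega>
  proof -
    have "X k \<omega> \<le> c * (Max ((\<lambda>k. V k \<omega>) ` {..N}))\<^sup>2" if "k \<le> N" for k
    proof -
      have "(V k \<omega>)\<^sup>2 \<le> (Max ((\<lambda>k. V k \<omega>) ` {..N}))\<^sup>2"
        using that V by (intro power_mono Max_ge) auto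
      then show ?thesis using X(3)[of k \<omega>] mult_left_mono[OF _ c] order_trans by blast
    qed
    then show ?thesis unfolding Sup_Max by simp
  qed
  have "(\<lambda>\<omega>. SUP k\<in>{..N}. X k \<omega>) \<in> borel_measurable M"
    unfolding Sup_Max using X(1) by (intro borel_measurable_Max) auto
  moreover have "norm (SUP k\<in>{..N}. X k \<omega>) \<le> norm (c * (Max ((\<lambda>k. V k \<omega>) ` {..N}))\<^sup>2)" for \<omega>
    unfolding real_norm_def abs_of_nonneg[OF nn] using le[of \<omega>] abs_ge_self order_trans by blast
  ultimately show int': "integrable M (\<lambda>\<omega>. SUP k\<in>{..N}. X k \<omega>)"
    by (intro Bochner_Integration.integrable_bound[OF integrable_mult_right[OF int, of c]]) auto
  show "(\<integral>\<omega>. (SUP k\<in>{..N}. X k \<omega>) \<partial>M) \<le> c * (\<integral>\<omega>. (Max ((\<lambda>k. V k \<omega>) ` {..N}))\<^sup>2 \<partial>M)"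
    using integral_mono[OF int' integrable_mult_right[OF int, of c] le] by simp
qed

lemma (in brownian_motion) gaussian_noise_increment:
  assumes \<Delta>: "0 < \<Delta>"
  shows "gaussian_noise M (\<lambda>k. F (real k * \<Delta>)) (\<lambda>k \<omega>. increment w \<Delta> \<omega> k / sqrt \<Delta>)"
proof
  fix k
  let ?s = "real k * \<Delta>" and ?t = "real (Suc k) * \<Delta>"
  have s: "0 \<le> ?s" "?s < ?t" using \<Delta> by (auto simp: field_simps)
  show "subalgebra M (F ?s)" by (rule subalgebra_F[OF s(1)])
  show "sets (F ?s) \<subseteq> sets (F ?t)" by (rule F_mono) (use s in auto)
  \<comment> \<open>Rescaling creates no new events: \<open>A\<close> is replaced by its preimage
    under division by \<open>sqrt \<Delta>\<close>.\<close>
  have "{(\<lambda>\<omega>. increment w \<Delta> \<omega> k / sqrt \<Delta>) -` A \<inter> space M | A. A \<in> sets borel}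
      \<subseteq> {(\<lambda>\<omega>. w ?t \<omega> - w ?s \<omega>) -` A \<inter> space M | A. A \<in> sets borel}"
  proof clarify
    fix A :: "real set" assume A: "A \<in> sets borel"
    have "(\<lambda>x. x / sqrt \<Delta>) -` A \<inter> space borel \<in> sets borel"
      by (rule measurable_sets[OF _ A]) simp
    then have "(\<lambda>x. x / sqrt \<Delta>) -` A \<in> sets borel" by simp
    then show "\<exists>A'. (\<lambda>\<omega>. increment w \<Delta> \<omega> k / sqrt \<Delta>) -` A \<inter> space M
        = (\<lambda>\<omega>. w ?t \<omega> - w ?s \<omega>) -` A' \<inter> space M \<and> A' \<in> sets borel"
      by (intro exI[of _ "(\<lambda>x. x / sqrt \<Delta>) -` A"]) (auto simp: increment_def)
  qed
  then show "indep_set (sets (F ?s))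
      {(\<lambda>\<omega>. increment w \<Delta> \<omega> k / sqrt \<Delta>) -` A \<inter> space M | A. A \<in> sets borel}"
    unfolding indep_set_def
    by (intro indep_sets_mono_sets[OF independent_increments[OF s, unfolded indep_set_def]])
       (auto split: bool.split)
  have "?t - ?s = \<Delta>" by (simp add: algebra_simps)
  then show "distributed M lborel (\<lambda>\<omega>. increment w \<Delta> \<omega> k / sqrt \<Delta>) std_normal_density"
    using normal_increments[OF s] \<Delta>
      normal_standard_normal_convert[of "sqrt \<Delta>" "\<lambda>\<omega>. w ?t \<omega> - w ?s \<omega>" 0]
    by (simp add: increment_def)
qed

text \<open>The absolute value makes this applicable to \<open>\<sigma>\<close>, whose sign is not
  fixed.\<close>

lemma norm_diff_le_of_square:
  assumes "(norm (h x - h y))\<^sup>2 \<le> c * (norm (x - y))\<^sup>2"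
  shows "norm (h x - h y) \<le> sqrt \<bar>c\<bar> * norm (x - y)"
proof -
  have "(norm (h x - h y))\<^sup>2 \<le> \<bar>c\<bar> * (norm (x - y))\<^sup>2"
    using assms mult_right_mono[OF abs_ge_self[of c], of "(norm (x - y))\<^sup>2"] by simp
  then show ?thesis
    using real_sqrt_le_mono by (fastforce simp: real_sqrt_mult)
qed

text \<open>Supplies the continuity of \<open>g\<close> and \<open>L1 g g\<close>, from which the
  measurability of the scheme is derived.\<close>

lemma continuous_of_square_lipschitz:
  fixes h :: "'a::real_normed_vector \<Rightarrow> 'b::real_normed_vector"
  assumes "\<And>x y. (norm (h x - h y))\<^sup>2 \<le> c * (norm (x - y))\<^sup>2"
  shows "continuous_on UNIV h"
  by (rule lipschitz_on_continuous_on[of "sqrt \<bar>c\<bar>"])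
     (auto intro!: lipschitz_onI norm_diff_le_of_square assms simp: dist_norm)

lemma linear_growth_of_square_lipschitz:
  fixes h :: "'a::real_normed_vector \<Rightarrow> 'b::real_normed_vector"
  assumes "\<And>x y. (norm (h x - h y))\<^sup>2 \<le> c * (norm (x - y))\<^sup>2"
  shows "norm (h x) \<le> (norm (h 0) + sqrt \<bar>c\<bar>) * sqrt (1 + (norm x)\<^sup>2)"
proof -
  have s: "1 \<le> sqrt (1 + (norm x)\<^sup>2)" "norm x \<le> sqrt (1 + (norm x)\<^sup>2)"
    by (auto intro: real_le_rsqrt)
  have "norm (h x) \<le> norm (h 0) + norm (h x - h 0)"
    using norm_triangle_ineq[of "h 0" "h x - h 0"] by simp
  also have "\<dots> \<le> norm (h 0) * 1 + sqrt \<bar>c\<bar> * norm x"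
    using norm_diff_le_of_square[of h x 0 c, OF assms] by simp
  also have "\<dots> \<le> norm (h 0) * sqrt (1 + (norm x)\<^sup>2) + sqrt \<bar>c\<bar> * sqrt (1 + (norm x)\<^sup>2)"
    using s by (intro add_mono mult_left_mono) auto
  finally show ?thesis by (simp add: algebra_simps)
qed

lemma SSTM_0: "SSTM f g \<theta> \<Delta> x0 w 0 \<omega> = x0 - (\<theta> * \<Delta>) *\<^sub>R f x0"
  by (simp add: SSTM_def)

lemma SSTM_Suc:
  "SSTM f g \<theta> \<Delta> x0 w (Suc k) \<omega> = (let y = STM f g \<theta> \<Delta> x0 w k \<omega>; u = increment w \<Delta> \<omega> k in
     SSTM f g \<theta> \<Delta> x0 w k \<omega> + \<Delta> *\<^sub>R f y + u *\<^sub>R g y + (1/2 * (u\<^sup>2 - \<Delta>)) *\<^sub>R L1 g g y)"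
  by (simp add: SSTM_def STM_def Let_def case_prod_beta)

lemma sqrt_one_plus_square_le: "0 \<le> t \<Longrightarrow> sqrt (1 + t\<^sup>2) \<le> 1 + t"
  by (rule real_le_lsqrt) (auto simp: power2_eq_square algebra_simps)

text \<open>Turns growth in \<open>y\<close> into growth in \<open>z\<close>:
  \<open>sqrt (1 + (norm y)\<^sup>2)\<close> is at most \<open>1 + 2 * norm z + D\<close>, and 1 and
  \<open>norm z\<close> are both below \<open>sqrt (1 + (norm z)\<^sup>2)\<close>, hence
  \<open>3 + D\<close>.\<close>

lemma linear_growth_compose:
  fixes h :: "'a::real_normed_vector \<Rightarrow> 'b::real_normed_vector"
  assumes h: "\<And>x. norm (h x) \<le> A * sqrt (1 + (norm x)\<^sup>2)" and A: "0 \<le> A"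
    and y: "norm y \<le> 2 * norm z + D" and D: "0 \<le> D"
  shows "norm (h y) \<le> A * (3 + D) * sqrt (1 + (norm z)\<^sup>2)"
proof -
  have s: "1 \<le> sqrt (1 + (norm z)\<^sup>2)" "norm z \<le> sqrt (1 + (norm z)\<^sup>2)"
    by (auto intro: real_le_rsqrt)
  have "sqrt (1 + (norm y)\<^sup>2) \<le> 1 + norm y" by (rule sqrt_one_plus_square_le) simp
  also have "\<dots> \<le> 1 + 2 * norm z + D * 1" using y by simp
  also have "\<dots> \<le> sqrt (1 + (norm z)\<^sup>2) + 2 * sqrt (1 + (norm z)\<^sup>2) + D * sqrt (1 + (norm z)\<^sup>2)"
    using s D by (intro add_mono mult_left_mono) auto
  finally have "sqrt (1 + (norm y)\<^sup>2) \<le> (3 + D) * sqrt (1 + (norm z)\<^sup>2)" by (simp add: algebra_simps)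
  then have "A * sqrt (1 + (norm y)\<^sup>2) \<le> A * ((3 + D) * sqrt (1 + (norm z)\<^sup>2))"
    using A by (rule mult_left_mono)
  then show ?thesis using h[of y] by (simp add: mult.assoc)
qed

text \<open>In the threshold \<open>4 * 2 ^ j\<close>, one factor 2 arises because \<open>a\<close>
  is quadratic in the norm, the other because the maximal inequality controls the square of
  \<open>a ^ 2 ^ j\<close>.\<close>

lemma powr_le_power_of_square_bound:
  assumes t: "0 \<le> t" "t \<le> A * sqrt a" and A: "0 \<le> A" and a: "1 \<le> a"
    and p: "0 \<le> p" "p \<le> 4 * 2 ^ j"
  shows "t powr p \<le> A powr p * (a ^ 2 ^ j)\<^sup>2"
proof -
  have "t powr p \<le> (A * sqrt a) powr p" using t p by (intro powr_mono2) auto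
  also have "\<dots> = A powr p * a powr (p / 2)"
    using A a by (simp add: powr_mult powr_half_sqrt[symmetric] powr_powr)
  also have "\<dots> \<le> A powr p * a powr (real (2 ^ j * 2))"
    using a p by (intro mult_left_mono powr_mono) auto
  also have "a powr (real (2 ^ j * 2)) = (a ^ 2 ^ j)\<^sup>2"
    using a by (subst powr_realpow) (auto simp: power_mult)
  finally show ?thesis .
qed

theorem theorem3p2:
  fixes M :: "'a measure" and F :: "real \<Rightarrow> 'a measure" and w :: "real \<Rightarrow> 'a \<Rightarrow> real"
    and f g :: "real^'n \<Rightarrow> real^'n" and \<mu> c \<sigma> K \<beta> \<theta> T p :: real and \<Delta>\<^sub>1 :: ereal
    and x0 :: "real^'n"
  assumes "brownian_motion M F w"
    and "C2 f" and "C2 g"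
    and "c > 0" and "K > 0"
    and "\<And>x y. (x - y) \<bullet> (f x - f y) \<le> \<mu> * (norm (x - y))\<^sup>2"
    and "\<And>x y. (norm (g x - g y))\<^sup>2 \<le> c * (norm (x - y))\<^sup>2"
    and "\<And>x y. (norm (L1 g g x - L1 g g y))\<^sup>2 \<le> \<sigma> * (norm (x - y))\<^sup>2"
    and "\<And>x. (norm (f x))\<^sup>2 \<le> K * (1 + (norm x)\<^sup>2)"
    and "\<beta> = max (\<mu> + 1/2) (2 * c)"
    and "0 \<le> \<theta>" and "\<theta> < 1/2" and "T > 0"
    and "\<Delta>\<^sub>1 = (if \<theta> = 0 then \<infinity> else ereal (1 / (2 * \<theta> * \<beta>)))"
    and "p \<ge> 2"
  shows "\<exists>C>0. \<forall>(N::nat) \<Delta>. N > 0 \<and> \<Delta> = T / real N \<and> ereal \<Delta> < \<Delta>\<^sub>1 \<longrightarrow>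
     (let Y = (\<lambda>\<omega>. SUP k\<in>{k. real k * \<Delta> \<in> {0..T}}. norm (STM f g \<theta> \<Delta> x0 w k \<omega>) powr p);
          Z = (\<lambda>\<omega>. SUP k\<in>{k. real k * \<Delta> \<in> {0..T}}. norm (SSTM f g \<theta> \<Delta> x0 w k \<omega>) powr p)
      in integrable M Y \<and> integral\<^sup>L M Y \<le> C \<and> integrable M Z \<and> integral\<^sup>L M Z \<le> C)"
proof -
  interpret brownian_motion M F w by fact
  note one_sided = assms(6) and g_lip = assms(7) and L_lip = assms(8) and f_growth = assms(9)
    and \<theta>0 = \<open>0 \<le> \<theta>\<close> and T0 = \<open>T > 0\<close>
  have cont_f: "continuous_on UNIV f"
    using \<open>C2 f\<close> unfolding C2_def
    by (meson continuous_at_imp_continuous_on has_derivative_continuous)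
  have cont_g: "continuous_on UNIV g" and cont_L: "continuous_on UNIV (L1 g g)"
    using continuous_of_square_lipschitz g_lip L_lip by blast+

  \<comment> \<open>Constants that do not depend on the step size\<close>
  define Af where "Af = sqrt K"
  define Ag where "Ag = norm (g 0) + sqrt \<bar>c\<bar>"
  define AL where "AL = norm (L1 g g 0) + sqrt \<bar>\<sigma>\<bar>"
  \<comment> \<open>Bounds the affine term \<open>2 * (\<theta> * \<Delta>) * norm (f 0)\<close> of
    the implicit solution for every \<open>\<Delta> \<le> T\<close>.\<close>
  define D where "D = 2 * (\<theta> * T) * norm (f 0)"
  \<comment> \<open>One growth constant for all three coefficients as functions of \<open>z\<close>;
    the sum dominates each summand.\<close>
  define B where "B = (Af + Ag + AL) * (3 + D)"
  have A0: "0 \<le> Af" "0 \<le> Ag" "0 \<le> AL" using \<open>K > 0\<close> by (auto simp: Af_def Ag_def AL_def)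
  have D0: "0 \<le> D" using \<theta>0 T0 by (simp add: D_def)
  have B0: "0 \<le> B" using A0 D0 by (simp add: B_def)
  have fB: "norm (f x) \<le> Af * sqrt (1 + (norm x)\<^sup>2)" for x
    using real_sqrt_le_mono[OF f_growth[of x]] by (simp add: Af_def real_sqrt_mult)
  have gB: "norm (g x) \<le> Ag * sqrt (1 + (norm x)\<^sup>2)" for x
    unfolding Ag_def using g_lip by (rule linear_growth_of_square_lipschitz)
  have LB: "norm (L1 g g x) \<le> AL * sqrt (1 + (norm x)\<^sup>2)" for x
    unfolding AL_def using L_lip by (rule linear_growth_of_square_lipschitz)
  have growth: "norm (h y) \<le> B * sqrt (1 + (norm z)\<^sup>2)"
    if "\<And>x. norm (h x) \<le> A * sqrt (1 + (norm x)\<^sup>2)" "0 \<le> A" "A \<le> Af + Ag + AL"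
      "norm y \<le> 2 * norm z + D" for h :: "real^'n \<Rightarrow> real^'n" and A y z
  proof -
    have "A * (3 + D) \<le> B" unfolding B_def using that(3) D0 by (intro mult_right_mono) auto
    then have "A * (3 + D) * sqrt (1 + (norm z)\<^sup>2) \<le> B * sqrt (1 + (norm z)\<^sup>2)"
      by (intro mult_right_mono) auto
    then show ?thesis
      using linear_growth_compose[of h A y z D] that D0 by (meson order_trans)
  qed

  define C0 where "C0 = 4 * B + 2 * B\<^sup>2 + 8 * B\<^sup>2 * T"
  have C0: "0 \<le> C0" using B0 T0 by (simp add: C0_def)
  obtain j :: nat where "p / 4 < 2 ^ j" using real_arch_pow[of 2 "p / 4"] by auto
  then have j: "p \<le> 4 * 2 ^ j" by simp
  obtain C' r' where C': "0 \<le> C'" and step_pow: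
    "\<And>\<epsilon> v V H V'. \<epsilon>\<^sup>2 \<le> T \<Longrightarrow> noise_step C0 2 \<epsilon> v V H V' \<Longrightarrow>
      noise_step C' r' \<epsilon> v (V ^ 2 ^ j) (2 ^ j * H * V ^ (2 ^ j - 1)) (V' ^ 2 ^ j)"
    using noise_step_power[OF C0, of T 2 j] by blast
  \<comment> \<open>Dominates the initial value of the Lyapunov function for every
    \<open>\<Delta> \<le> T\<close>, although \<open>z\<close> starts at a point depending on
    \<open>\<Delta>\<close>.\<close>
  define W where "W = (1 + (norm x0 + \<theta> * T * norm (f x0))\<^sup>2) ^ 2 ^ j"
  define R where "R = 8 * (1 + (C' * gauss_moment r' * T)\<^sup>2)
      * exp ((2 * C' + 2 * C'\<^sup>2 + 2 * C'\<^sup>2 * T) * gauss_moment (2 * r' + 1) * T) * W\<^sup>2"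
  have R0: "0 \<le> R" by (simp add: R_def)

  \<comment> \<open>One argument serves both schemes, since both norms are at most
    \<open>2 * norm (z k \<omega>) + D\<close>. The summand 1 makes the final constant strictly
    positive.\<close>
  have main: "integrable M (\<lambda>\<omega>. SUP k\<in>{k. real k * \<Delta> \<in> {0..T}}. norm (X k \<omega>) powr p)
      \<and> (\<integral>\<omega>. (SUP k\<in>{k. real k * \<Delta> \<in> {0..T}}. norm (X k \<omega>) powr p) \<partial>M) \<le> (3 + D) powr p * R + 1"
    if N: "N > 0" and \<Delta>: "\<Delta> = T / real N" and \<Delta>_less: "ereal \<Delta> < \<Delta>\<^sub>1"
      and X: "X = STM f g \<theta> \<Delta> x0 w \<or> X = SSTM f g \<theta> \<Delta> x0 w" for N \<Delta> X
  proof -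

    \<comment> \<open>The scheme for a fixed step size: solvability, recursion and
      adaptedness\<close>
    define y where "y = STM f g \<theta> \<Delta> x0 w"
    define z where "z = SSTM f g \<theta> \<Delta> x0 w"
    define v where "v = (\<lambda>k \<omega>. increment w \<Delta> \<omega> k / sqrt \<Delta>)"
    define G where "G = (\<lambda>k. F (real k * \<Delta>))"
    have \<Delta>0: "0 < \<Delta>" and \<Delta>T: "\<Delta> \<le> T" and N\<Delta>: "real N * \<Delta> = T"
      using N T0 by (auto simp: \<Delta> field_simps)
    interpret gaussian_noise M G v
      unfolding G_def v_def by (rule gaussian_noise_increment[OF \<Delta>0])
    \<comment> \<open>Here the restriction \<open>\<Delta> < \<Delta>\<^sub>1\<close> enters: it
      gives \<open>\<theta> * \<Delta> * \<beta> < 1/2\<close>, and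
      \<open>\<mu> \<le> \<beta>\<close>. For \<open>\<theta> = 0\<close> the product is 0.\<close>
    have \<theta>\<Delta>: "0 \<le> \<theta> * \<Delta>" "\<theta> * \<Delta> * \<mu> \<le> 1/2"
    proof -
      show "0 \<le> \<theta> * \<Delta>" using \<theta>0 \<Delta>0 by simp
      show "\<theta> * \<Delta> * \<mu> \<le> 1/2"
      proof (cases "\<theta> = 0")
        case False
        then have "0 < \<theta>" using \<theta>0 by simp
        have "0 < \<beta>" "\<mu> \<le> \<beta>" using \<open>c > 0\<close> \<open>\<beta> = _\<close> by auto
        have "\<Delta> < 1 / (2 * \<theta> * \<beta>)" using \<Delta>_less False \<open>\<Delta>\<^sub>1 = _\<close> by simp
        then have "\<theta> * \<Delta> * \<beta> < 1/2" using \<open>0 < \<theta>\<close> \<open>0 < \<beta>\<close> by (simp add: field_simps)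
        moreover have "\<theta> * \<Delta> * \<mu> \<le> \<theta> * \<Delta> * \<beta>"
          using \<theta>0 \<Delta>0 \<open>\<mu> \<le> \<beta>\<close> by (intro mult_left_mono) auto
        ultimately show ?thesis by linarith
      qed simp
    qed
    note implicit = cont_f one_sided \<theta>\<Delta>
    \<comment> \<open>The initial \<open>z\<close> is chosen so that \<open>x0\<close> solves its
      implicit equation; hence the relation holds at \<open>k = 0\<close> too.\<close>
    have y_eq: "y k \<omega> = implicit_solution f \<theta> \<Delta> (z k \<omega>)" for k \<omega>
    proof (cases k)
      case 0
      then show ?thesis
        using implicit_solution_iff[OF implicit, of "x0 - (\<theta> * \<Delta>) *\<^sub>R f x0" x0]
        by (simp add: y_def z_def STM_def SSTM_def)
    next
      case (Suc k)
      then show ?thesis by (simp add: y_def z_def STM_def SSTM_def Let_def case_prod_beta)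
    qed
    have y_le: "norm (y k \<omega>) \<le> 2 * norm (z k \<omega>) + D" for k \<omega>
    proof -
      have "2 * (\<theta> * \<Delta>) * norm (f 0) \<le> D"
        unfolding D_def using \<theta>0 \<Delta>T by (intro mult_right_mono mult_left_mono) auto
      then show ?thesis
        unfolding y_eq using norm_implicit_solution_le[OF implicit, of "z k \<omega>"] by linarith
    qed
    \<comment> \<open>The step is written with \<open>sqrt \<Delta>\<close> as
      \<open>\<epsilon>\<close> and a normalised increment, the form required by
      \<open>noise_step_milstein\<close>.\<close>
    have z_Suc: "z (Suc k) \<omega> = z k \<omega> + (sqrt \<Delta>)\<^sup>2 *\<^sub>R f (y k \<omega>) + (sqrt \<Delta> * v k \<omega>) *\<^sub>R g (y k \<omega>)
        + (1/2 * ((sqrt \<Delta> * v k \<omega>)\<^sup>2 - (sqrt \<Delta>)\<^sup>2)) *\<^sub>R L1 g g (y k \<omega>)" for k \<omega>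
      using \<Delta>0 by (simp add: z_def y_def SSTM_Suc Let_def v_def)
    have noise_meas: "v k \<in> borel_measurable (G (Suc k))" for k
    proof -
      have "w (real (Suc k) * \<Delta>) \<in> borel_measurable (G (Suc k))"
        unfolding G_def using \<Delta>0 by (intro adapted) simp
      moreover have "w (real k * \<Delta>) \<in> borel_measurable (G k)"
        unfolding G_def using \<Delta>0 by (intro adapted) simp
      then have "w (real k * \<Delta>) \<in> borel_measurable (G (Suc k))"
        by (rule measurable_G_mono[rotated]) simp
      ultimately show ?thesis unfolding v_def increment_def by simp
    qed
    have meas_y: "(\<lambda>\<omega>. h (y k \<omega>)) \<in> borel_measurable (G i)"
      if "z k \<in> borel_measurable (G i)" "continuous_on UNIV h" for h :: "real^'n \<Rightarrow> real^'n" and k i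
      unfolding y_eq
      by (intro borel_measurable_continuous_on[OF that(2)]
          borel_measurable_continuous_on[OF continuous_implicit_solution[OF implicit]] that(1))
    have z_meas: "z k \<in> borel_measurable (G k)" for k
    proof (induction k)
      case 0
      have "z 0 = (\<lambda>\<omega>. x0 - (\<theta> * \<Delta>) *\<^sub>R f x0)" by (simp add: z_def SSTM_0 fun_eq_iff)
      then show ?case by simp
    next
      case (Suc k)
      then have zk: "z k \<in> borel_measurable (G (Suc k))" by (rule measurable_G_mono[rotated]) simp
      have "z (Suc k) = (\<lambda>\<omega>. z k \<omega> + (sqrt \<Delta>)\<^sup>2 *\<^sub>R f (y k \<omega>) + (sqrt \<Delta> * v k \<omega>) *\<^sub>R g (y k \<omega>)
        + (1/2 * ((sqrt \<Delta> * v k \<omega>)\<^sup>2 - (sqrt \<Delta>)\<^sup>2)) *\<^sub>R L1 g g (y k \<omega>))"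
        using z_Suc by (rule ext)
      then show ?case
        using zk noise_meas[of k] meas_y[OF zk cont_f] meas_y[OF zk cont_g] meas_y[OF zk cont_L]
        by simp
    qed
    have y_meas: "y k \<in> borel_measurable (G k)" for k
      using meas_y[OF z_meas continuous_on_id] by simp

    \<comment> \<open>The Lyapunov function and its maximal second moment\<close>
    define a where "a = (\<lambda>k \<omega>. 1 + (norm (z k \<omega>))\<^sup>2)"
    define V where "V = (\<lambda>k \<omega>. a k \<omega> ^ 2 ^ j)"
    \<comment> \<open>The noise coefficient that \<open>step_pow\<close> produces from
      \<open>2 * (z k \<omega> \<bullet> g (y k \<omega>))\<close>, the coefficient for
      \<open>a\<close>.\<close>
    define H where "H = (\<lambda>k \<omega>. 2 ^ j * (2 * (z k \<omega> \<bullet> g (y k \<omega>))) * a k \<omega> ^ (2 ^ j - 1))"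
    have a1: "1 \<le> a k \<omega>" for k \<omega> by (simp add: a_def)
    have V_nn: "0 \<le> V k \<omega>" for k \<omega> using a1[of k \<omega>] by (simp add: V_def)
    have step: "noise_step C' r' (sqrt \<Delta>) (v k \<omega>) (V k \<omega>) (H k \<omega>) (V (Suc k) \<omega>)" for k \<omega>
    proof -
      have "noise_step C0 2 (sqrt \<Delta>) (v k \<omega>) (a k \<omega>) (2 * (z k \<omega> \<bullet> g (y k \<omega>))) (a (Suc k) \<omega>)"
        unfolding a_def z_Suc C0_def
      proof (rule noise_step_milstein[OF B0])
        show "norm (f (y k \<omega>)) \<le> B * sqrt (1 + (norm (z k \<omega>))\<^sup>2)"
          using fB A0 y_le by (intro growth[of f Af]) auto
        show "norm (g (y k \<omega>)) \<le> B * sqrt (1 + (norm (z k \<omega>))\<^sup>2)"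
          using gB A0 y_le by (intro growth[of g Ag]) auto
        show "norm (L1 g g (y k \<omega>)) \<le> B * sqrt (1 + (norm (z k \<omega>))\<^sup>2)"
          using LB A0 y_le by (intro growth[of "L1 g g" AL]) auto
        show "(sqrt \<Delta>)\<^sup>2 \<le> T" using \<Delta>0 \<Delta>T by simp
      qed
      then show ?thesis
        unfolding V_def H_def using \<Delta>0 \<Delta>T by (intro step_pow) auto
    qed
    have a_meas: "a k \<in> borel_measurable (G k)" for k
      using z_meas unfolding a_def by simp
    have V_meas: "V k \<in> borel_measurable (G k)" for k
      using a_meas unfolding V_def by simp
    have H_meas: "H k \<in> borel_measurable (G k)" for k
      using a_meas z_meas meas_y[OF z_meas cont_g] unfolding H_def by simp
    have V0_eq: "V 0 \<omega> = (1 + (norm (x0 - (\<theta> * \<Delta>) *\<^sub>R f x0))\<^sup>2) ^ 2 ^ j" for \<omega>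
      by (simp add: V_def a_def z_def SSTM_0)
    have V0_W: "V 0 \<omega> \<le> W" for \<omega>
    proof -
      have "norm (x0 - (\<theta> * \<Delta>) *\<^sub>R f x0) \<le> norm x0 + \<theta> * \<Delta> * norm (f x0)"
        using norm_triangle_ineq4[of x0 "(\<theta> * \<Delta>) *\<^sub>R f x0"] \<theta>\<Delta> by simp
      also have "\<dots> \<le> norm x0 + \<theta> * T * norm (f x0)"
        using \<theta>0 \<Delta>T by (intro add_left_mono mult_right_mono mult_left_mono) auto
      finally show ?thesis
        unfolding V0_eq W_def by (intro power_mono add_left_mono) auto
    qed
    have V0_int: "integrable M (\<lambda>\<omega>. (V 0 \<omega>)\<^sup>2)" unfolding V0_eq by simp
    have "(\<integral>\<omega>. (V 0 \<omega>)\<^sup>2 \<partial>M) \<le> (\<integral>\<omega>. W\<^sup>2 \<partial>M)"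
      using V0_W V_nn by (intro integral_mono V0_int power_mono) auto
    then have V0_le: "(\<integral>\<omega>. (V 0 \<omega>)\<^sup>2 \<partial>M) \<le> W\<^sup>2" by (simp add: prob_space)
    have time: "real N * (sqrt \<Delta>)\<^sup>2 \<le> T" "(sqrt \<Delta>)\<^sup>2 \<le> T" using \<Delta>0 \<Delta>T N\<Delta> by auto
    note maximal = noise_step_maximal[OF V_meas H_meas step C' V0_int time]
    have Max_le: "(\<integral>\<omega>. (Max ((\<lambda>k. V k \<omega>) ` {..N}))\<^sup>2 \<partial>M) \<le> R"
      unfolding R_def by (rule order_trans[OF maximal(2)]) (intro mult_left_mono V0_le, simp)

    \<comment> \<open>Transfer to the norms of both schemes\<close>
    have X_meas: "X k \<in> borel_measurable M" for k
      using X measurable_G_imp_M[OF z_meas] measurable_G_imp_M[OF y_meas] by (auto simp: y_def z_def)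
    have X_le: "norm (X k \<omega>) powr p \<le> (3 + D) powr p * (V k \<omega>)\<^sup>2" for k \<omega>
    proof -
      have s: "norm (z k \<omega>) \<le> sqrt (a k \<omega>)" "1 \<le> sqrt (a k \<omega>)"
        by (auto simp: a_def intro: real_le_rsqrt)
      have "norm (X k \<omega>) \<le> 2 * norm (z k \<omega>) + D"
        using X y_le[of k \<omega>] D0 by (auto simp: y_def z_def)
      also have "\<dots> \<le> 2 * sqrt (a k \<omega>) + D * sqrt (a k \<omega>)"
        using s D0 mult_left_mono[OF s(2) D0] by simp
      also have "\<dots> \<le> (3 + D) * sqrt (a k \<omega>)" using s by (simp add: algebra_simps)
      finally show ?thesis
        unfolding V_def using a1 D0 j \<open>p \<ge> 2\<close> by (intro powr_le_power_of_square_bound) auto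
    qed
    \<comment> \<open>Since \<open>real N * \<Delta> = T\<close>, the grid has \<open>N + 1\<close>
      points and includes the endpoint \<open>T\<close>.\<close>
    have set_eq: "{k. real k * \<Delta> \<in> {0..T}} = {..N}"
    proof -
      have "real k * \<Delta> \<le> T \<longleftrightarrow> k \<le> N" for k
        unfolding N\<Delta>[symmetric] using \<Delta>0 by simp
      then show ?thesis using \<Delta>0 by auto
    qed
    have pn: "(\<lambda>\<omega>. norm (X k \<omega>) powr p) \<in> borel_measurable M" for k
      using X_meas by simp
    note SUP_bound = SUP_moment_bound[of "\<lambda>k \<omega>. norm (X k \<omega>) powr p" M "(3 + D) powr p" V N,
        OF pn powr_ge_zero X_le V_nn powr_ge_zero maximal(1)]
    show ?thesis
      unfolding set_eq using SUP_bound mult_left_mono[OF Max_le powr_ge_zero[of "3 + D" p]] by simp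
  qed
  have "0 < (3 + D) powr p * R + 1"
    using R0 by (intro add_nonneg_pos mult_nonneg_nonneg) auto
  then show ?thesis
    using main by (intro exI[of _ "(3 + D) powr p * R + 1"]) (simp add: Let_def)
qed

end
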